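(* Let $H$ be a Poisson algebra. Then the following conclusions hold. (1) Suppose that $H$ is a Hopf-Galois algebra with the Hopf-Galois map $\mu$. If there is an algebra map $\alpha:H\to k$ such that $\{H,H\}\subseteq \mathrm{Ker}\,\alpha$, then $H$ has a structure of Poisson Hopf algebra. (2) If $H$ is a Poisson Hopf algebra, then $H$ is also a Poisson Hopf-Galois algebra.
   Context: Everything is over a fixed field $k$; algebras are associative and unital, and $\otimes=\otimes_k$. A Hopf-Galois algebra is a non-zero algebra $R$ together with an algebra map $\mu:R\to R\otimes R^{op}\otimes R$ (where the target is the tensor product algebra; $\mu$ is called the Hopf-Galois map), written $\mu(r)=r_{(1)}\otimes r_{(2)}\otimes r_{(3)}$ with summation suppressed, such that $(\mu\otimes id\otimes id)\circ\mu=(id\otimes id\otimes\mu)\circ\mu$, $(m\otimes id)\circ\mu=\eta\otimes id$ and $(id\otimes m)\circ\mu=id\otimes\eta$, where $m$ and $\eta$ are the multiplication and unit of $R$; the last two conditions say $r_{(1)}r_{(2)}\otimes r_{(3)}=1\otimes r$ and $r_{(1)}\otimes r_{(2)}r_{(3)}=r\otimes 1$ for all $r\in R$. A Poisson algebra is a commutative algebra $A$ with a bilinear map $\{\cdot,\cdot\}:A\otimes A\to A$ making $A$ a Lie algebra and satisfying $\{a,bc\}=\{a,b\}c+b\{a,c\}$ for all $a,b,c\in A$. For Poisson algebras $A,B$, the algebra $A\otimes B$ is a Poisson algebra with $\{a\otimes b,a'\otimes b'\}_{A\otimes B}=aa'\otimes\{b,b'\}+\{a,a'\}\otimes bb'$.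 A Poisson Hopf algebra is a Poisson algebra $A$ that is also a Hopf algebra (with the same multiplication), with comultiplication $\Delta$, such that $\Delta(\{a,b\})=\{\Delta(a),\Delta(b)\}_{A\otimes A}$ for all $a,b\in A$. A Poisson Hopf-Galois algebra is a Poisson algebra $R$ that is also a Hopf-Galois algebra (with the same multiplication) such that the Hopf-Galois map satisfies $\mu(\{a,b\})=\{\mu(a),\mu(b)\}$ for all $a,b\in R$, where the Poisson bracket on $R\otimes R^{op}\otimes R$ is $$\{x\otimes y\otimes z,\,x'\otimes y'\otimes z'\}=\{x,x'\}\otimes yy'\otimes zz'-xx'\otimes\{y,y'\}\otimes zz'+xx'\otimes yy'\otimes\{z,z'\}.$$
   Formalization: In (1), the Hopf-Galois map is additionally assumed to respect the bracket, μ({a,b})={μ(a),μ(b)}, i.e. H is a Poisson Hopf-Galois algebra; without this (1) fails, e.g. for k[x^{±1},y^{±1}] with {x,y}=x−1 and α(x)=α(y)=1. *)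

theory Defs
  imports "HOL.Vector_Spaces" "HOL-Library.Poly_Mapping"
begin

section \<open>Tensor powers of a vector space\<close>

text \<open>
  The free vector space over a field \<open>'k\<close> on a set of generators \<open>'b\<close> is the type
  \<open>'b \<Rightarrow>\<^sub>0 'k\<close> of finitely supported functions, with the following scalar multiplication.
\<close>

definition free_scale :: "'k::field \<Rightarrow> ('b \<Rightarrow>\<^sub>0 'k) \<Rightarrow> ('b \<Rightarrow>\<^sub>0 'k)" where
  "free_scale c = Poly_Mapping.map ((*) c)"

lemma lookup_free_scale [simp]: "Poly_Mapping.lookup (free_scale c p) x = c * Poly_Mapping.lookup p x"
  by (simp add: free_scale_def Poly_Mapping.map.rep_eq when_def)

global_interpretation free: vector_space "free_scale :: 'k::field \<Rightarrow> ('b \<Rightarrow>\<^sub>0 'k) \<Rightarrow> _"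
  by unfold_locales
    (auto intro!: poly_mapping_eqI simp: lookup_add algebra_simps)

abbreviation gen :: "'b \<Rightarrow> 'b \<Rightarrow>\<^sub>0 'k::field" where
  "gen x \<equiv> Poly_Mapping.single x 1"

text \<open>The linear extension of a map defined on generators, with values in a vector space
  whose scalar multiplication is \<open>s\<close>.\<close>

definition lin_ext :: "('k::field \<Rightarrow> 'v::ab_group_add \<Rightarrow> 'v) \<Rightarrow> ('b \<Rightarrow> 'v) \<Rightarrow> ('b \<Rightarrow>\<^sub>0 'k) \<Rightarrow> 'v" where
  "lin_ext s f p = (\<Sum>x\<in>Poly_Mapping.keys p. s (Poly_Mapping.lookup p x) (f x))"

text \<open>The juxtaposition product on the free vector space on lists.\<close>

definition juxtapose :: "('b list \<Rightarrow>\<^sub>0 'k::field) \<Rightarrow> ('b list \<Rightarrow>\<^sub>0 'k) \<Rightarrow> ('b list \<Rightarrow>\<^sub>0 'k)" where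
  "juxtapose p q =
     lin_ext free_scale (\<lambda>xs. lin_ext free_scale (\<lambda>ys. gen (xs @ ys)) q) p"

text \<open>
  The \<open>n\<close>-th tensor power of a vector space \<open>V\<close> over the field \<open>'a\<close> is the quotient of the free
  vector space on the lists of length \<open>n\<close> over \<open>V\<close> by the span of the multilinearity relations.
  As the scalar multiplication of \<open>V\<close> is a term, this quotient is not a type: its
  elements are cosets, and it comes as a carrier set.
\<close>

context vector_space
begin

definition tensor_relators :: "nat \<Rightarrow> ('b list \<Rightarrow>\<^sub>0 'a) set" where
  "tensor_relators n =
     {gen (xs @ (u + v) # ys) - gen (xs @ u # ys) - gen (xs @ v # ys) | xs u v ys.
        length xs + 1 + length ys = n} \<union>
     {gen (xs @ scale c u # ys) - free_scale c (gen (xs @ u # ys)) | xs c u ys.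
        length xs + 1 + length ys = n}"

definition tensor_class :: "nat \<Rightarrow> ('b list \<Rightarrow>\<^sub>0 'a) \<Rightarrow> ('b list \<Rightarrow>\<^sub>0 'a) set" where
  "tensor_class n p = {q. q - p \<in> free.span (tensor_relators n)}"

definition tensor_power :: "nat \<Rightarrow> ('b list \<Rightarrow>\<^sub>0 'a) set set" where
  "tensor_power n = tensor_class n ` {p. Poly_Mapping.keys p \<subseteq> {xs. length xs = n}}"

text \<open>Operations on tensors are defined on a chosen representative. All of those below which
  involve maps on \<open>V\<close> are only meaningful (i.e. independent of the choice) when these
  maps are linear, respectively bilinear or multilinear.\<close>

definition tensor_rep :: "('b list \<Rightarrow>\<^sub>0 'a) set \<Rightarrow> ('b list \<Rightarrow>\<^sub>0 'a)" where
  "tensor_rep X = (SOME p. p \<in> X)"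

definition tensor_add :: "nat \<Rightarrow> ('b list \<Rightarrow>\<^sub>0 'a) set \<Rightarrow> ('b list \<Rightarrow>\<^sub>0 'a) set \<Rightarrow> ('b list \<Rightarrow>\<^sub>0 'a) set" where
  "tensor_add n X Y = tensor_class n (tensor_rep X + tensor_rep Y)"

definition tensor_diff :: "nat \<Rightarrow> ('b list \<Rightarrow>\<^sub>0 'a) set \<Rightarrow> ('b list \<Rightarrow>\<^sub>0 'a) set \<Rightarrow> ('b list \<Rightarrow>\<^sub>0 'a) set" where
  "tensor_diff n X Y = tensor_class n (tensor_rep X - tensor_rep Y)"

definition tensor_scale :: "nat \<Rightarrow> 'a \<Rightarrow> ('b list \<Rightarrow>\<^sub>0 'a) set \<Rightarrow> ('b list \<Rightarrow>\<^sub>0 'a) set" where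
  "tensor_scale n c X = tensor_class n (free_scale c (tensor_rep X))"

text \<open>The pure tensor \<open>x\<^sub>1 \<otimes> \<dots> \<otimes> x\<^sub>n\<close>.\<close>

definition pure :: "'b list \<Rightarrow> ('b list \<Rightarrow>\<^sub>0 'a) set" where
  "pure xs = tensor_class (length xs) (gen xs)"

definition linear_to_tensors :: "nat \<Rightarrow> ('b \<Rightarrow> ('b list \<Rightarrow>\<^sub>0 'a) set) \<Rightarrow> bool" where
  "linear_to_tensors n f \<longleftrightarrow>
     (\<forall>x. f x \<in> tensor_power n) \<and>
     (\<forall>x y. f (x + y) = tensor_add n (f x) (f y)) \<and>
     (\<forall>c x. f (scale c x) = tensor_scale n c (f x))"

text \<open>The linear map from a tensor power to \<open>V\<close> sending \<open>x\<^sub>1 \<otimes> \<dots> \<otimes> x\<^sub>n\<close> to \<open>f [x\<^sub>1, \<dots>, x\<^sub>n]\<close>.\<close>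

definition tensor_eval :: "('b list \<Rightarrow> 'b) \<Rightarrow> ('b list \<Rightarrow>\<^sub>0 'a) set \<Rightarrow> 'b" where
  "tensor_eval f X = lin_ext scale f (tensor_rep X)"

text \<open>The linear map from a tensor power to the \<open>n\<close>-th tensor power sending
  \<open>x\<^sub>1 \<otimes> \<dots> \<otimes> x\<^sub>m\<close> to the class of \<open>f [x\<^sub>1, \<dots>, x\<^sub>m]\<close>.\<close>

definition tensor_map ::
    "nat \<Rightarrow> ('b list \<Rightarrow> ('b list \<Rightarrow>\<^sub>0 'a)) \<Rightarrow> ('b list \<Rightarrow>\<^sub>0 'a) set \<Rightarrow> ('b list \<Rightarrow>\<^sub>0 'a) set" where
  "tensor_map n f X = tensor_class n (lin_ext free_scale f (tensor_rep X))"

text \<open>For linear maps \<open>f\<^sub>i\<close> from \<open>V\<close> to its \<open>n\<^sub>i\<close>-th tensor power, the map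
  \<open>f\<^sub>1 \<otimes> \<dots> \<otimes> f\<^sub>m\<close> from the \<open>m\<close>-th to the \<open>n\<close>-th tensor power, where \<open>n = n\<^sub>1 + \<dots> + n\<^sub>m\<close>.
  The identity factor is \<open>\<lambda>x. pure [x]\<close>.\<close>

definition tensor_of_maps ::
    "nat \<Rightarrow> ('b \<Rightarrow> ('b list \<Rightarrow>\<^sub>0 'a) set) list \<Rightarrow> ('b list \<Rightarrow>\<^sub>0 'a) set \<Rightarrow> ('b list \<Rightarrow>\<^sub>0 'a) set" where
  "tensor_of_maps n fs =
     tensor_map n (\<lambda>xs. foldr juxtapose (map2 (\<lambda>f x. tensor_rep (f x)) fs xs) (gen []))"

text \<open>For bilinear maps \<open>\<beta>\<^sub>i\<close> on \<open>V\<close>, the bilinear map on the \<open>n\<close>-th tensor power sending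
  \<open>(x\<^sub>1 \<otimes> \<dots> \<otimes> x\<^sub>n, y\<^sub>1 \<otimes> \<dots> \<otimes> y\<^sub>n)\<close> to \<open>\<beta>\<^sub>1 x\<^sub>1 y\<^sub>1 \<otimes> \<dots> \<otimes> \<beta>\<^sub>n x\<^sub>n y\<^sub>n\<close>.\<close>

definition tensor_of_bilinear ::
    "('b \<Rightarrow> 'b \<Rightarrow> 'b) list \<Rightarrow> ('b list \<Rightarrow>\<^sub>0 'a) set \<Rightarrow> ('b list \<Rightarrow>\<^sub>0 'a) set \<Rightarrow> ('b list \<Rightarrow>\<^sub>0 'a) set" where
  "tensor_of_bilinear \<beta>s X Y =
     tensor_class (length \<beta>s)
       (lin_ext free_scale
          (\<lambda>xs. lin_ext free_scale
            (\<lambda>ys. gen (map2 (\<lambda>\<beta> (x, y). \<beta> x y) \<beta>s (zip xs ys))) (tensor_rep Y))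
          (tensor_rep X))"

end


section \<open>Algebras, Hopf algebras and Hopf-Galois algebras\<close>

locale k_algebra = vector_space scale
  for scale :: "'k::field \<Rightarrow> 'a::ring_1 \<Rightarrow> 'a" +
  assumes scale_mult_left: "scale c x * y = scale c (x * y)"
    and scale_mult_right: "x * scale c y = scale c (x * y)"
begin

text \<open>Algebra maps to the base field.\<close>

definition character :: "('a \<Rightarrow> 'k) \<Rightarrow> bool" where
  "character \<alpha> \<longleftrightarrow>
     Vector_Spaces.linear scale (*) \<alpha> \<and> \<alpha> 1 = 1 \<and> (\<forall>x y. \<alpha> (x * y) = \<alpha> x * \<alpha> y)"

end

locale hopf_algebra = k_algebra scale
  for scale :: "'k::field \<Rightarrow> 'a::ring_1 \<Rightarrow> 'a" +
  fixes \<Delta> :: "'a \<Rightarrow> ('a list \<Rightarrow>\<^sub>0 'k) set"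
    and \<epsilon> :: "'a \<Rightarrow> 'k"
    and S :: "'a \<Rightarrow> 'a"
  assumes comult_linear: "linear_to_tensors 2 \<Delta>"
    and comult_one: "\<Delta> 1 = pure [1, 1]"
    and comult_mult: "\<Delta> (x * y) = tensor_of_bilinear [(*), (*)] (\<Delta> x) (\<Delta> y)"
    and counit_character: "character \<epsilon>"
    and coassoc:
      "tensor_of_maps 3 [\<Delta>, \<lambda>x. pure [x]] (\<Delta> x) = tensor_of_maps 3 [\<lambda>x. pure [x], \<Delta>] (\<Delta> x)"
    and counit_left:
      "tensor_eval (\<lambda>xs. case xs of [u, v] \<Rightarrow> scale (\<epsilon> u) v | _ \<Rightarrow> 0) (\<Delta> x) = x"
    and counit_right:
      "tensor_eval (\<lambda>xs. case xs of [u, v] \<Rightarrow> scale (\<epsilon> v) u | _ \<Rightarrow> 0) (\<Delta> x) = x"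
    and antipode_linear: "Vector_Spaces.linear scale scale S"
    and antipode_left:
      "tensor_eval (\<lambda>xs. case xs of [u, v] \<Rightarrow> S u * v | _ \<Rightarrow> 0) (\<Delta> x) = scale (\<epsilon> x) 1"
    and antipode_right:
      "tensor_eval (\<lambda>xs. case xs of [u, v] \<Rightarrow> u * S v | _ \<Rightarrow> 0) (\<Delta> x) = scale (\<epsilon> x) 1"

text \<open>As a vector space, \<open>R \<otimes> R\<^sup>o\<^sup>p \<otimes> R\<close> is the third tensor power of \<open>R\<close>; only the
  multiplication of the middle factor is reversed. That \<open>R\<close> is non-zero is part of the
  class \<^class>\<open>ring_1\<close>.\<close>

locale hopf_galois_algebra = k_algebra scale
  for scale :: "'k::field \<Rightarrow> 'a::ring_1 \<Rightarrow> 'a" +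
  fixes \<mu> :: "'a \<Rightarrow> ('a list \<Rightarrow>\<^sub>0 'k) set"
  assumes hg_linear: "linear_to_tensors 3 \<mu>"
    and hg_one: "\<mu> 1 = pure [1, 1, 1]"
    and hg_mult: "\<mu> (x * y) = tensor_of_bilinear [(*), \<lambda>u v. v * u, (*)] (\<mu> x) (\<mu> y)"
    and hg_coassoc:
      "tensor_of_maps 5 [\<mu>, \<lambda>x. pure [x], \<lambda>x. pure [x]] (\<mu> x) =
       tensor_of_maps 5 [\<lambda>x. pure [x], \<lambda>x. pure [x], \<mu>] (\<mu> x)"
    and hg_left:
      "tensor_map 2 (\<lambda>xs. case xs of [u, v, w] \<Rightarrow> gen [u * v, w] | _ \<Rightarrow> 0) (\<mu> x) = pure [1, x]"
    and hg_right:
      "tensor_map 2 (\<lambda>xs. case xs of [u, v, w] \<Rightarrow> gen [u, v * w] | _ \<Rightarrow> 0) (\<mu> x) = pure [x, 1]"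


section \<open>Poisson structures\<close>

locale poisson_algebra = k_algebra scale
  for scale :: "'k::field \<Rightarrow> 'a::comm_ring_1 \<Rightarrow> 'a" +
  fixes br :: "'a \<Rightarrow> 'a \<Rightarrow> 'a"
  assumes br_linear_left: "Vector_Spaces.linear scale scale (\<lambda>x. br x y)"
    and br_linear_right: "Vector_Spaces.linear scale scale (br x)"
    and br_alternating: "br x x = 0"
    and br_jacobi: "br x (br y z) + br y (br z x) + br z (br x y) = 0"
    and br_leibniz: "br x (y * z) = br x y * z + y * br x z"
begin

definition br_tensor2 :: "('a list \<Rightarrow>\<^sub>0 'k) set \<Rightarrow> ('a list \<Rightarrow>\<^sub>0 'k) set \<Rightarrow> ('a list \<Rightarrow>\<^sub>0 'k) set" where
  "br_tensor2 X Y =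
     tensor_add 2 (tensor_of_bilinear [(*), br] X Y) (tensor_of_bilinear [br, (*)] X Y)"

text \<open>The bracket on \<open>R \<otimes> R\<^sup>o\<^sup>p \<otimes> R\<close>, where the bracket of the middle factor enters with a
  negative sign.\<close>

definition br_tensor3 :: "('a list \<Rightarrow>\<^sub>0 'k) set \<Rightarrow> ('a list \<Rightarrow>\<^sub>0 'k) set \<Rightarrow> ('a list \<Rightarrow>\<^sub>0 'k) set" where
  "br_tensor3 X Y =
     tensor_add 3
       (tensor_diff 3 (tensor_of_bilinear [br, (*), (*)] X Y) (tensor_of_bilinear [(*), br, (*)] X Y))
       (tensor_of_bilinear [(*), (*), br] X Y)"

end

locale poisson_hopf_algebra =
  poisson_algebra scale br + hopf_algebra scale \<Delta> \<epsilon> S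
  for scale :: "'k::field \<Rightarrow> 'a::comm_ring_1 \<Rightarrow> 'a" and br \<Delta> \<epsilon> S +
  assumes comult_br: "\<Delta> (br x y) = br_tensor2 (\<Delta> x) (\<Delta> y)"

locale poisson_hopf_galois_algebra =
  poisson_algebra scale br + hopf_galois_algebra scale \<mu>
  for scale :: "'k::field \<Rightarrow> 'a::comm_ring_1 \<Rightarrow> 'a" and br \<mu> +
  assumes hg_br: "\<mu> (br x y) = br_tensor3 (\<mu> x) (\<mu> y)"

end

theory Submission
  imports Defs
begin

text \<open>
  A tensor is determined by the values of all scalar-valued multilinear maps on it, so every identity
  between tensors is an identity between sums in Sweedler notation, taken over representatives.

  Given a Hopf-Galois map \<open>\<mu>\<close> and an algebra map \<open>\<alpha>\<close>, the Hopf structure has counit \<open>\<alpha>\<close>,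
  \<open>\<Delta> r = \<alpha>(r\<^sub>2) r\<^sub>1 \<otimes> r\<^sub>3\<close> and \<open>S r = \<alpha>(r\<^sub>1) \<alpha>(r\<^sub>3) r\<^sub>2\<close>; the middle bracket
  term of \<open>\<mu> {x, y}\<close> dies because \<open>\<alpha>\<close> kills brackets. Conversely, a Hopf algebra has the
  Hopf-Galois map \<open>\<mu> h = h\<^sub>1 \<otimes> S h\<^sub>2 \<otimes> h\<^sub>3\<close>. It respects the brackets because the antipode is an
  anti-Poisson map, \<open>S {x, y} = {S y, S x}\<close>: both sides have the same convolution with the
  multiplication, and convolution with the multiplication is invertible.
\<close>

section \<open>Linear extensions\<close>

text \<open>Tensors are cosets and their operations use chosen representatives, so an equation
  between tensors cannot be computed directly. Separation by functionals moves it into sums with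
  values in a vector space, where representatives may be exchanged as long as the integrand is
  multilinear. This is why almost every Sweedler step carries linearity side conditions. The model
  behind the formulas is the ternary operation (a, b, c) |-> a b^-1 c on a torsor, whose dual is
  \<open>\<mu>\<close>. A character plays the part of a base point e; then a e^-1 c is a group
  product with inverse b |-> e b^-1 e, and the formulas for \<open>\<Delta>\<close> and
  \<open>S\<close> are the duals of these two. In the converse direction e is the unit of the group,
  and a b^-1 c dualizes to the formula for \<open>\<mu>\<close>. The sign in the anti-Poisson law of
  the antipode is the sign that the bracket of the opposite middle factor carries.\<close>

lemma lin_ext_superset:
  assumes "vector_space s" "finite A" "Poly_Mapping.keys p \<subseteq> A"
  shows "lin_ext s f p = (\<Sum>x\<in>A. s (Poly_Mapping.lookup p x) (f x))"
proof -
  interpret vector_space s by fact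
  show ?thesis unfolding lin_ext_def
    by (rule sum.mono_neutral_left) (use assms in \<open>auto simp: in_keys_iff\<close>)
qed

lemma linear_lin_ext:
  assumes "vector_space s"
  shows "Vector_Spaces.linear free_scale s (lin_ext s f)"
proof -
  interpret vector_space s by fact
  have add: "lin_ext s f (p + q) = lin_ext s f p + lin_ext s f q" for p q
  proof -
    let ?A = "Poly_Mapping.keys p \<union> Poly_Mapping.keys q"
    have "Poly_Mapping.keys (p + q) \<subseteq> ?A" by (rule Poly_Mapping.keys_add)
    then show ?thesis
      by (simp add: lin_ext_superset[OF assms, of ?A] lookup_add scale_left_distrib sum.distrib)
  qed
  have scale: "lin_ext s f (free_scale c p) = s c (lin_ext s f p)" for c p
  proof -
    have "Poly_Mapping.keys (free_scale c p) \<subseteq> Poly_Mapping.keys p"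
      by (auto simp: in_keys_iff)
    then show ?thesis
      by (simp add: lin_ext_superset[OF assms, of "Poly_Mapping.keys p"] scale_sum_right)
  qed
  show ?thesis
    unfolding linear_iff using assms add scale free.vector_space_axioms by auto
qed

lemma lin_ext_gen:
  assumes "vector_space s"
  shows "lin_ext s f (gen x) = f x"
proof -
  interpret vector_space s by fact
  show ?thesis by (simp add: lin_ext_def)
qed

lemma lin_ext_cong:
  "(\<And>x. x \<in> Poly_Mapping.keys p \<Longrightarrow> f x = g x) \<Longrightarrow> lin_ext s f p = lin_ext s g p"
  by (simp add: lin_ext_def)

lemma linear_comp_lin_ext:
  assumes "Vector_Spaces.linear s t T"
  shows "T (lin_ext s f p) = lin_ext t (\<lambda>x. T (f x)) p"
proof -
  interpret Vector_Spaces.linear s t T by fact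
  show ?thesis by (simp add: lin_ext_def sum scale)
qed

lemma linear_eq_lin_ext:
  assumes "Vector_Spaces.linear free_scale t T"
  shows "T p = lin_ext t (\<lambda>x. T (gen x)) p"
proof -
  have "p = lin_ext free_scale gen p"
    by (rule poly_mapping_eqI)
      (simp add: lin_ext_def lookup_sum lookup_single when_def in_keys_iff if_distrib cong: if_cong)
  then show ?thesis
    using linear_comp_lin_ext[OF assms] by metis
qed

text \<open>The parameter sits in the integrand. Linearity is asked for on the support only, because
  an integrand is usually controlled only on lists of the right length.\<close>

lemma linear_lin_ext_param:
  assumes "vector_space r" "vector_space s"
    "\<And>x. x \<in> Poly_Mapping.keys p \<Longrightarrow> Vector_Spaces.linear r s (\<lambda>u. f u x)"
  shows "Vector_Spaces.linear r s (\<lambda>u. lin_ext s (f u) p)"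
proof -
  interpret vector_space_pair r s using assms by unfold_locales (auto simp: vector_space_def)
  show ?thesis unfolding lin_ext_def
    by (intro linear_compose_sum ballI linear_compose_scale_right assms)
qed

lemma lin_ext_swap:
  assumes "vector_space s"
  shows "lin_ext s (\<lambda>x. lin_ext s (\<lambda>y. f x y) q) p = lin_ext s (\<lambda>y. lin_ext s (\<lambda>x. f x y) p) q"
proof -
  interpret vector_space s by fact
  show ?thesis unfolding lin_ext_def scale_sum_right
    by (subst sum.swap) (simp add: mult.commute)
qed

lemma lin_ext_juxtapose:
  assumes "vector_space s"
  shows "lin_ext s F (juxtapose p q) = lin_ext s (\<lambda>xs. lin_ext s (\<lambda>ys. F (xs @ ys)) q) p"
  unfolding juxtapose_def
  by (simp add: linear_comp_lin_ext[OF linear_lin_ext[OF assms]] lin_ext_gen[OF assms])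

lemma keys_lin_ext_subset:
  assumes "\<And>x. x \<in> Poly_Mapping.keys p \<Longrightarrow> Poly_Mapping.keys (f x) \<subseteq> A"
  shows "Poly_Mapping.keys (lin_ext free_scale f p) \<subseteq> A"
proof
  fix y assume "y \<in> Poly_Mapping.keys (lin_ext free_scale f p)"
  then have "(\<Sum>x\<in>Poly_Mapping.keys p. Poly_Mapping.lookup p x * Poly_Mapping.lookup (f x) y) \<noteq> 0"
    unfolding lin_ext_def by (simp add: in_keys_iff lookup_sum)
  then obtain x where x: "x \<in> Poly_Mapping.keys p"
      "Poly_Mapping.lookup p x * Poly_Mapping.lookup (f x) y \<noteq> 0"
    by (rule sum.not_neutral_contains_not_neutral)
  then have "y \<in> Poly_Mapping.keys (f x)" by (simp add: in_keys_iff)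
  then show "y \<in> A" using assms[OF x(1)] by blast
qed

lemma vector_space_mult: "vector_space ((*) :: 'k::field \<Rightarrow> 'k \<Rightarrow> 'k)"
  by unfold_locales (auto simp: algebra_simps)

section \<open>Multilinear maps separate the elements of a tensor power\<close>

context vector_space
begin

text \<open>\<open>vector_space s\<close> is a conjunct of its own because the condition on the
  slots is vacuous for \<open>n = 0\<close>.\<close>

definition multilinear :: "nat \<Rightarrow> ('a \<Rightarrow> 'v::ab_group_add \<Rightarrow> 'v) \<Rightarrow> ('b list \<Rightarrow> 'v) \<Rightarrow> bool" where
  "multilinear n s F \<longleftrightarrow> vector_space s \<and>
     (\<forall>xs ys. length xs + 1 + length ys = n \<longrightarrow> Vector_Spaces.linear scale s (\<lambda>u. F (xs @ u # ys)))"

lemma multilinear_vector_space: "multilinear n s F \<Longrightarrow> vector_space s"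
  by (simp add: multilinear_def)

lemma multilinearD:
  "multilinear n s F \<Longrightarrow> length xs + 1 + length ys = n \<Longrightarrow>
    Vector_Spaces.linear scale s (\<lambda>u. F (xs @ u # ys))"
  by (simp add: multilinear_def)

lemma multilinear_append_left:
  "multilinear (m + n) s F \<Longrightarrow> length as = m \<Longrightarrow> multilinear n s (\<lambda>bs. F (as @ bs))"
  unfolding multilinear_def
  by (auto simp: append_assoc[symmetric] simp del: append_assoc)

lemma multilinear_append_right:
  "multilinear (m + n) s F \<Longrightarrow> length bs = n \<Longrightarrow> multilinear m s (\<lambda>as. F (as @ bs))"
  unfolding multilinear_def by (simp add: add.assoc[symmetric])

text \<open>Each relator records the failure of additivity or homogeneity in one slot, and linearity
  of \<open>F\<close> in that slot sends it to 0. This is the easy half of the universal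
  property.\<close>

lemma lin_ext_relators:
  assumes "multilinear n s F" "p \<in> free.span (tensor_relators n)"
  shows "lin_ext s F p = 0"
proof -
  have s: "vector_space s" using assms(1) by (rule multilinear_vector_space)
  interpret L: Vector_Spaces.linear free_scale s "lin_ext s F" using s by (rule linear_lin_ext)
  have rel: "lin_ext s F q = 0" if "q \<in> tensor_relators n" for q
  proof -
    from that consider
      (add) xs u v ys where "length xs + 1 + length ys = n"
        "q = gen (xs @ (u + v) # ys) - gen (xs @ u # ys) - gen (xs @ v # ys)"
    | (smul) xs c u ys where "length xs + 1 + length ys = n"
        "q = gen (xs @ scale c u # ys) - free_scale c (gen (xs @ u # ys))"
      unfolding tensor_relators_def by blast
    then show ?thesis
    proof cases
      case add
      interpret F: Vector_Spaces.linear scale s "\<lambda>u. F (xs @ u # ys)"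
        using assms(1) add(1) by (rule multilinearD)
      show ?thesis using add(2)
        by (simp add: L.diff lin_ext_gen[OF s] F.add)
    next
      case smul
      interpret F: Vector_Spaces.linear scale s "\<lambda>u. F (xs @ u # ys)"
        using assms(1) smul(1) by (rule multilinearD)
      show ?thesis using smul(2)
        by (simp add: L.diff L.scale lin_ext_gen[OF s] F.scale)
    qed
  qed
  show ?thesis
    using L.eq_0_on_span[OF rel assms(2)] .
qed

text \<open>Relators involve lists of length \<open>n\<close> only. Hence every representative of an
  element of \<open>tensor_power n\<close>, including the chosen one, is supported on such
  lists.\<close>

lemma keys_span_relators:
  assumes "p \<in> free.span (tensor_relators n)"
  shows "Poly_Mapping.keys p \<subseteq> {xs. length xs = n}"
  using assms
proof (induction rule: free.span_induct_alt)
  case base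
  then show ?case by simp
next
  case (step c q p)
  have "Poly_Mapping.keys q \<subseteq> {xs. length xs = n}"
    using step(1) unfolding tensor_relators_def
    by (auto simp: in_keys_iff lookup_minus lookup_single when_def split: if_splits)
  moreover have "Poly_Mapping.keys (free_scale c q + p) \<subseteq> Poly_Mapping.keys q \<union> Poly_Mapping.keys p"
    by (auto simp: in_keys_iff lookup_add)
  ultimately show ?case using step(2) by blast
qed

lemma tensor_rep_class: "tensor_rep (tensor_class n p) - p \<in> free.span (tensor_relators n)"
proof -
  have "p \<in> tensor_class n p" by (simp add: tensor_class_def free.span_zero)
  then have "tensor_rep (tensor_class n p) \<in> tensor_class n p"
    unfolding tensor_rep_def by (rule someI)
  then show ?thesis by (simp add: tensor_class_def)
qed

lemma tensor_class_eqI: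
  assumes "q - p \<in> free.span (tensor_relators n)"
  shows "tensor_class n q = tensor_class n p"
proof -
  have "r - q \<in> free.span (tensor_relators n) \<longleftrightarrow> r - p \<in> free.span (tensor_relators n)" for r
    using free.span_add_eq2[OF assms, of "r - q"] by simp
  then show ?thesis by (auto simp: tensor_class_def)
qed

lemma tensor_class_rep: "X \<in> range (tensor_class n) \<Longrightarrow> tensor_class n (tensor_rep X) = X"
  using tensor_class_eqI tensor_rep_class by fastforce

lemma tensor_power_class: "X \<in> tensor_power n \<Longrightarrow> X \<in> range (tensor_class n)"
  by (auto simp: tensor_power_def)

lemma keys_tensor_rep:
  assumes "X \<in> tensor_power n"
  shows "Poly_Mapping.keys (tensor_rep X) \<subseteq> {xs. length xs = n}"
proof -
  obtain p where p: "X = tensor_class n p" "Poly_Mapping.keys p \<subseteq> {xs. length xs = n}"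
    using assms by (auto simp: tensor_power_def)
  have "Poly_Mapping.keys (tensor_rep X - p) \<subseteq> {xs. length xs = n}"
    unfolding p(1) by (intro keys_span_relators tensor_rep_class)
  moreover have "Poly_Mapping.keys (tensor_rep X) \<subseteq>
      Poly_Mapping.keys (tensor_rep X - p) \<union> Poly_Mapping.keys p"
    using Poly_Mapping.keys_add[of "tensor_rep X - p" p] by simp
  ultimately show ?thesis using p(2) by blast
qed

text \<open>If \<open>p\<close> is not in the span \<open>W\<close> of the relators, a basis of \<open>W\<close> together with \<open>p\<close> is
  independent, so that some linear functional vanishes on \<open>W\<close> but not at \<open>p\<close>.\<close>

lemma span_relators_if_multilinear:
  assumes "\<And>\<phi>. multilinear n ((*) :: 'a \<Rightarrow> 'a \<Rightarrow> 'a) \<phi> \<Longrightarrow> lin_ext (*) \<phi> p = 0"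
  shows "p \<in> free.span (tensor_relators n)"
proof (rule ccontr)
  assume notin: "p \<notin> free.span (tensor_relators n)"
  interpret k: vector_space "(*) :: 'a \<Rightarrow> 'a \<Rightarrow> 'a" by (rule vector_space_mult)
  interpret pair: vector_space_pair "free_scale :: 'a \<Rightarrow> ('b list \<Rightarrow>\<^sub>0 'a) \<Rightarrow> _" "(*) :: 'a \<Rightarrow> 'a \<Rightarrow> 'a"
    by unfold_locales
  obtain B where B: "B \<subseteq> tensor_relators n" "free.independent B"
      "tensor_relators n \<subseteq> free.span B"
    using free.maximal_independent_subset by blast
  have "free.span B = free.span (tensor_relators n)"
    by (metis B(1,3) free.span_eq free.span_superset subset_trans)
  with notin B(2) have "free.independent (insert p B)"
    by (intro free.independent_insertI) auto
  from pair.linear_independent_extend[OF this, of "\<lambda>x. if x = p then 1 else 0"]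
  obtain g where g: "Vector_Spaces.linear free_scale (*) g"
      "\<And>x. x \<in> insert p B \<Longrightarrow> g x = (if x = p then 1 else 0)" by blast
  interpret g: Vector_Spaces.linear free_scale "(*)" g by (rule g(1))
  have "p \<notin> B" using notin B(1) free.span_base by blast
  then have "g x = 0" if "x \<in> B" for x using g(2) that by auto
  then have "g x = 0" if "x \<in> free.span B" for x using that g.eq_0_on_span by blast
  then have rel: "g x = 0" if "x \<in> tensor_relators n" for x using B(3) that by blast
  \<comment> \<open>On generators, vanishing on the two families of relators says exactly additivity
    and homogeneity in each slot.\<close>
  have "multilinear n (*) (\<lambda>xs. g (gen xs))"
    unfolding multilinear_def linear_iff
  proof (intro conjI allI impI k.vector_space_axioms vector_space_axioms)
    fix xs ys :: "'b list" and u v c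
    assume len: "length xs + 1 + length ys = n"
    have "g (gen (xs @ (u + v) # ys) - gen (xs @ u # ys) - gen (xs @ v # ys)) = 0"
      by (rule rel) (use len tensor_relators_def in blast)
    then show "g (gen (xs @ (u + v) # ys)) = g (gen (xs @ u # ys)) + g (gen (xs @ v # ys))"
      by (simp add: g.diff g.add diff_diff_eq)
    have "g (gen (xs @ scale c u # ys) - free_scale c (gen (xs @ u # ys))) = 0"
      by (rule rel) (use len tensor_relators_def in blast)
    then show "g (gen (xs @ scale c u # ys)) = c * g (gen (xs @ u # ys))"
      by (simp add: g.diff g.scale)
  qed
  then have "lin_ext (*) (\<lambda>xs. g (gen xs)) p = 0" by (rule assms)
  then have "g p = 0" using linear_eq_lin_ext[OF g(1), of p] by simp
  then show False using g(2)[of p] by simp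
qed

section \<open>Evaluation of tensors at multilinear maps\<close>

definition tensor_sum :: "('a \<Rightarrow> 'v::ab_group_add \<Rightarrow> 'v) \<Rightarrow> ('b list \<Rightarrow>\<^sub>0 'a) set \<Rightarrow> ('b list \<Rightarrow> 'v) \<Rightarrow> 'v"
  where "tensor_sum s X F = lin_ext s F (tensor_rep X)"

text \<open>Independence of the representative: exchanging it adds an element of the span of the
  relators, where \<open>lin_ext s F\<close> vanishes.\<close>

lemma tensor_sum_class:
  assumes "multilinear n s F"
  shows "tensor_sum s (tensor_class n p) F = lin_ext s F p"
proof -
  interpret L: Vector_Spaces.linear free_scale s "lin_ext s F"
    using assms by (intro linear_lin_ext multilinear_vector_space)
  have "lin_ext s F (tensor_rep (tensor_class n p) - p) = 0"
    using assms tensor_rep_class by (rule lin_ext_relators)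
  then show ?thesis by (simp add: tensor_sum_def L.diff)
qed

text \<open>The hard half of the universal property, as an extensionality rule. The premises ask
  only for cosets, not for elements of \<open>tensor_power n\<close>; for the results of tensor
  operations this is immediate from their definitions.\<close>

lemma tensor_eqI:
  assumes "X \<in> range (tensor_class n)" "Y \<in> range (tensor_class n)"
    and "\<And>\<phi>. multilinear n ((*) :: 'a \<Rightarrow> 'a \<Rightarrow> 'a) \<phi> \<Longrightarrow> tensor_sum (*) X \<phi> = tensor_sum (*) Y \<phi>"
  shows "X = Y"
proof -
  have "tensor_rep X - tensor_rep Y \<in> free.span (tensor_relators n)"
  proof (rule span_relators_if_multilinear)
    fix \<phi> assume \<phi>: "multilinear n ((*) :: 'a \<Rightarrow> 'a \<Rightarrow> 'a) \<phi>"
    interpret L: Vector_Spaces.linear free_scale "(*) :: 'a \<Rightarrow> 'a \<Rightarrow> 'a" "lin_ext (*) \<phi>"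
      by (intro linear_lin_ext vector_space_mult)
    show "lin_ext (*) \<phi> (tensor_rep X - tensor_rep Y) = 0"
      using assms(3)[OF \<phi>] by (simp add: tensor_sum_def L.diff)
  qed
  then show ?thesis
    using tensor_class_eqI tensor_class_rep assms(1,2) by metis
qed

lemma tensor_ops_class:
  "tensor_add n X Y \<in> range (tensor_class n)"
  "tensor_diff n X Y \<in> range (tensor_class n)"
  "tensor_scale n c X \<in> range (tensor_class n)"
  "tensor_map n f X \<in> range (tensor_class n)"
  "tensor_of_maps n fs X \<in> range (tensor_class n)"
  "length \<beta>s = n \<Longrightarrow> tensor_of_bilinear \<beta>s X Y \<in> range (tensor_class n)"
  "length xs = n \<Longrightarrow> pure xs \<in> range (tensor_class n)"
  by (auto simp: tensor_add_def tensor_diff_def tensor_scale_def tensor_map_def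
      tensor_of_maps_def tensor_of_bilinear_def pure_def)

lemma pure_tensor_power: "length xs = n \<Longrightarrow> pure xs \<in> tensor_power n"
  by (auto simp: pure_def tensor_power_def)

lemma
  assumes F: "multilinear n s F"
  shows tensor_sum_add: "tensor_sum s (tensor_add n X Y) F = tensor_sum s X F + tensor_sum s Y F"
    and tensor_sum_diff: "tensor_sum s (tensor_diff n X Y) F = tensor_sum s X F - tensor_sum s Y F"
    and tensor_sum_scale: "tensor_sum s (tensor_scale n c X) F = s c (tensor_sum s X F)"
    and tensor_sum_map:
      "tensor_sum s (tensor_map n f X) F = tensor_sum s X (\<lambda>xs. lin_ext s F (f xs))"
    and tensor_sum_pure: "length xs = n \<Longrightarrow> tensor_sum s (pure xs) F = F xs"
    and tensor_sum_bilinear: "length \<beta>s = n \<Longrightarrow> tensor_sum s (tensor_of_bilinear \<beta>s X Y) F =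
      tensor_sum s X (\<lambda>xs. tensor_sum s Y (\<lambda>ys. F (map2 (\<lambda>\<beta> (x, y). \<beta> x y) \<beta>s (zip xs ys))))"
proof -
  have s: "vector_space s" using F by (rule multilinear_vector_space)
  interpret L: Vector_Spaces.linear free_scale s "lin_ext s F" using s by (rule linear_lin_ext)
  note [simp] = tensor_sum_class[OF F] linear_comp_lin_ext[OF linear_lin_ext[OF s]] lin_ext_gen[OF s]
  show "tensor_sum s (tensor_add n X Y) F = tensor_sum s X F + tensor_sum s Y F"
    "tensor_sum s (tensor_diff n X Y) F = tensor_sum s X F - tensor_sum s Y F"
    "tensor_sum s (tensor_scale n c X) F = s c (tensor_sum s X F)"
    by (simp_all add: tensor_add_def tensor_diff_def tensor_scale_def L.add L.diff L.scale)
      (simp_all add: tensor_sum_def)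
  show "tensor_sum s (tensor_map n f X) F = tensor_sum s X (\<lambda>xs. lin_ext s F (f xs))"
    by (simp add: tensor_map_def) (simp add: tensor_sum_def)
  show "length xs = n \<Longrightarrow> tensor_sum s (pure xs) F = F xs"
    by (auto simp: pure_def)
  show "length \<beta>s = n \<Longrightarrow> tensor_sum s (tensor_of_bilinear \<beta>s X Y) F =
      tensor_sum s X (\<lambda>xs. tensor_sum s Y (\<lambda>ys. F (map2 (\<lambda>\<beta> (x, y). \<beta> x y) \<beta>s (zip xs ys))))"
    by (simp add: tensor_of_bilinear_def) (simp add: tensor_sum_def)
qed

lemma tensor_sum_cong:
  assumes "X \<in> tensor_power n" "\<And>xs. length xs = n \<Longrightarrow> F xs = G xs"
  shows "tensor_sum s X F = tensor_sum s X G"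
  unfolding tensor_sum_def
  by (rule lin_ext_cong) (use assms keys_tensor_rep in blast)

lemma linear_tensor_sum_param:
  assumes "vector_space s" "X \<in> tensor_power n"
    "\<And>xs. length xs = n \<Longrightarrow> Vector_Spaces.linear scale s (\<lambda>u. F u xs)"
  shows "Vector_Spaces.linear scale s (\<lambda>u. tensor_sum s X (F u))"
  unfolding tensor_sum_def
  by (rule linear_lin_ext_param)
    (use assms vector_space_axioms keys_tensor_rep[OF assms(2)] in auto)

lemma linear_comp_tensor_sum:
  "Vector_Spaces.linear s t T \<Longrightarrow> T (tensor_sum s X F) = tensor_sum t X (\<lambda>xs. T (F xs))"
  unfolding tensor_sum_def by (rule linear_comp_lin_ext)

lemma tensor_sum_swap:
  "vector_space s \<Longrightarrow> tensor_sum s X (\<lambda>xs. tensor_sum s Y (\<lambda>ys. F xs ys)) =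
    tensor_sum s Y (\<lambda>ys. tensor_sum s X (\<lambda>xs. F xs ys))"
  unfolding tensor_sum_def by (rule lin_ext_swap)

lemma linear_to_tensors_power: "linear_to_tensors n f \<Longrightarrow> f x \<in> tensor_power n"
  by (simp add: linear_to_tensors_def)

lemma linear_tensor_sum:
  assumes "linear_to_tensors n f" "multilinear n s F"
  shows "Vector_Spaces.linear scale s (\<lambda>x. tensor_sum s (f x) F)"
  unfolding linear_iff using assms vector_space_axioms multilinear_vector_space
  by (auto simp: linear_to_tensors_def tensor_sum_add tensor_sum_scale)

text \<open>Scalar multilinear maps separate tensors, so linearity of a tensor-valued map can be
  tested after composing with them.\<close>

lemma linear_to_tensorsI:
  assumes "\<And>x. f x \<in> tensor_power n"
    and "\<And>\<phi>. multilinear n (*) \<phi> \<Longrightarrow> Vector_Spaces.linear scale (*) (\<lambda>x. tensor_sum (*) (f x) \<phi>)"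
  shows "linear_to_tensors n f"
  unfolding linear_to_tensors_def
proof (intro conjI allI assms(1))
  show "f (x + y) = tensor_add n (f x) (f y)" for x y
    by (rule tensor_eqI[OF tensor_power_class[OF assms(1)] tensor_ops_class(1)])
      (use assms(2) in \<open>simp add: tensor_sum_add linear_iff\<close>)
  show "f (scale c x) = tensor_scale n c (f x)" for c x
    by (rule tensor_eqI[OF tensor_power_class[OF assms(1)] tensor_ops_class(3)])
      (use assms(2) in \<open>simp add: tensor_sum_scale linear_iff\<close>)
qed

lemma lin_ext_juxtapose_rep:
  "vector_space s \<Longrightarrow> lin_ext s F (juxtapose (tensor_rep X) q) =
    tensor_sum s X (\<lambda>xs. lin_ext s (\<lambda>ys. F (xs @ ys)) q)"
  by (simp add: lin_ext_juxtapose tensor_sum_def)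

lemma tensor_map_power:
  assumes "X \<in> tensor_power m"
    and "\<And>xs. length xs = m \<Longrightarrow> Poly_Mapping.keys (f xs) \<subseteq> {ys. length ys = n}"
  shows "tensor_map n f X \<in> tensor_power n"
proof -
  have "Poly_Mapping.keys (lin_ext free_scale f (tensor_rep X)) \<subseteq> {ys. length ys = n}"
    by (rule keys_lin_ext_subset) (use assms keys_tensor_rep in blast)
  then show ?thesis by (auto simp: tensor_map_def tensor_power_def)
qed

end

section \<open>Sums in Sweedler notation\<close>

lemma linear_compose_app:
  "Vector_Spaces.linear s t f \<Longrightarrow> Vector_Spaces.linear r s g \<Longrightarrow> Vector_Spaces.linear r t (\<lambda>x. f (g x))"
  unfolding linear_iff by simp

lemma linear_scale_const:
  "vector_space t \<Longrightarrow> Vector_Spaces.linear r (*) f \<Longrightarrow> Vector_Spaces.linear r t (\<lambda>u. t (f u) c)"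
  unfolding linear_iff by (auto simp: vector_space_def)

lemma linear_const_scale:
  "Vector_Spaces.linear r t f \<Longrightarrow> Vector_Spaces.linear r t (\<lambda>u. t c (f u))"
  unfolding linear_iff by (auto simp: vector_space_def mult.commute)

context vector_space
begin

definition bilinear_map :: "('a \<Rightarrow> 'v::ab_group_add \<Rightarrow> 'v) \<Rightarrow> ('b \<Rightarrow> 'b \<Rightarrow> 'v) \<Rightarrow> bool" where
  "bilinear_map s F \<longleftrightarrow>
     (\<forall>v. Vector_Spaces.linear scale s (\<lambda>u. F u v)) \<and> (\<forall>u. Vector_Spaces.linear scale s (F u))"

definition trilinear_map :: "('a \<Rightarrow> 'v::ab_group_add \<Rightarrow> 'v) \<Rightarrow> ('b \<Rightarrow> 'b \<Rightarrow> 'b \<Rightarrow> 'v) \<Rightarrow> bool" where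
  "trilinear_map s F \<longleftrightarrow>
     (\<forall>v w. Vector_Spaces.linear scale s (\<lambda>u. F u v w)) \<and>
     (\<forall>u w. Vector_Spaces.linear scale s (\<lambda>v. F u v w)) \<and>
     (\<forall>u v. Vector_Spaces.linear scale s (F u v))"

text \<open>Currying lets integrands be written with Sweedler variables, and \<open>!\<close> avoids
  a case distinction on the shape of the list. For elements of \<open>tensor_power 2\<close> the
  translation back is \<open>tensor_sum_eq_sum2\<close>.\<close>

definition sum2 :: "('a \<Rightarrow> 'v::ab_group_add \<Rightarrow> 'v) \<Rightarrow> ('b list \<Rightarrow>\<^sub>0 'a) set \<Rightarrow> ('b \<Rightarrow> 'b \<Rightarrow> 'v) \<Rightarrow> 'v" where
  "sum2 s X F = tensor_sum s X (\<lambda>xs. F (xs ! 0) (xs ! 1))"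

definition sum3 ::
    "('a \<Rightarrow> 'v::ab_group_add \<Rightarrow> 'v) \<Rightarrow> ('b list \<Rightarrow>\<^sub>0 'a) set \<Rightarrow> ('b \<Rightarrow> 'b \<Rightarrow> 'b \<Rightarrow> 'v) \<Rightarrow> 'v" where
  "sum3 s X F = tensor_sum s X (\<lambda>xs. F (xs ! 0) (xs ! 1) (xs ! 2))"

lemma bilinear_mapI:
  "(\<And>v. Vector_Spaces.linear scale s (\<lambda>u. F u v)) \<Longrightarrow> (\<And>u. Vector_Spaces.linear scale s (\<lambda>v. F u v))
    \<Longrightarrow> bilinear_map s F"
  by (simp add: bilinear_map_def)

lemma trilinear_mapI:
  "(\<And>v w. Vector_Spaces.linear scale s (\<lambda>u. F u v w)) \<Longrightarrow>
   (\<And>u w. Vector_Spaces.linear scale s (\<lambda>v. F u v w)) \<Longrightarrow>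
   (\<And>u v. Vector_Spaces.linear scale s (\<lambda>w. F u v w)) \<Longrightarrow> trilinear_map s F"
  by (simp add: trilinear_map_def)

text \<open>The inner linear map \<open>g\<close> makes these usable as introduction rules that
  descend through nested arguments such as \<open>F (u * S a) b\<close>.\<close>

lemma bilinear_map_linear:
  assumes "bilinear_map s F" "Vector_Spaces.linear r scale g"
  shows "Vector_Spaces.linear r s (\<lambda>u. F (g u) v)" "Vector_Spaces.linear r s (\<lambda>v. F u (g v))"
  using linear_compose_app[OF _ assms(2), of s "\<lambda>u. F u v"] linear_compose_app[OF _ assms(2), of s "F u"]
    assms(1) by (auto simp: bilinear_map_def)

lemma trilinear_map_linear:
  assumes "trilinear_map s F" "Vector_Spaces.linear r scale g"
  shows "Vector_Spaces.linear r s (\<lambda>u. F (g u) v w)" "Vector_Spaces.linear r s (\<lambda>v. F u (g v) w)"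
    "Vector_Spaces.linear r s (\<lambda>w. F u v (g w))"
  using linear_compose_app[OF _ assms(2), of s "\<lambda>u. F u v w"]
    linear_compose_app[OF _ assms(2), of s "\<lambda>v. F u v w"]
    linear_compose_app[OF _ assms(2), of s "F u v"]
    assms(1) by (auto simp: trilinear_map_def)

lemma bilinear_map_vector_space: "bilinear_map s F \<Longrightarrow> vector_space s"
  by (auto simp: bilinear_map_def linear_iff)

lemma trilinear_map_vector_space: "trilinear_map s F \<Longrightarrow> vector_space s"
  by (auto simp: trilinear_map_def linear_iff)

lemma multilinear_2:
  assumes "bilinear_map s F"
  shows "multilinear 2 s (\<lambda>xs. F (xs ! 0) (xs ! 1))"
  unfolding multilinear_def
proof (intro conjI allI impI)
  show "vector_space s" using assms by (rule bilinear_map_vector_space)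
  fix xs ys :: "'b list"
  assume "length xs + 1 + length ys = 2"
  then consider "length xs = 0" "length ys = 1" | "length xs = 1" "length ys = 0" by linarith
  then show "Vector_Spaces.linear scale s (\<lambda>u. F ((xs @ u # ys) ! 0) ((xs @ u # ys) ! 1))"
    by cases (use assms in \<open>simp_all add: bilinear_map_def nth_append\<close>)
qed

lemma multilinear_3:
  assumes "trilinear_map s F"
  shows "multilinear 3 s (\<lambda>xs. F (xs ! 0) (xs ! 1) (xs ! 2))"
  unfolding multilinear_def
proof (intro conjI allI impI)
  show "vector_space s" using assms by (rule trilinear_map_vector_space)
  fix xs ys :: "'b list"
  assume "length xs + 1 + length ys = 3"
  then consider "length xs = 0" "length ys = 2" | "length xs = 1" "length ys = 1"
    | "length xs = 2" "length ys = 0" by linarith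
  then show "Vector_Spaces.linear scale s
      (\<lambda>u. F ((xs @ u # ys) ! 0) ((xs @ u # ys) ! 1) ((xs @ u # ys) ! 2))"
    by cases (use assms in \<open>simp_all add: trilinear_map_def nth_append\<close>)
qed

lemma multilinear_5:
  assumes "vector_space s"
    and "\<And>v w x y. Vector_Spaces.linear scale s (\<lambda>u. F u v w x y)"
    and "\<And>u w x y. Vector_Spaces.linear scale s (\<lambda>v. F u v w x y)"
    and "\<And>u v x y. Vector_Spaces.linear scale s (\<lambda>w. F u v w x y)"
    and "\<And>u v w y. Vector_Spaces.linear scale s (\<lambda>x. F u v w x y)"
    and "\<And>u v w x. Vector_Spaces.linear scale s (\<lambda>y. F u v w x y)"
  shows "multilinear 5 s (\<lambda>xs. F (xs ! 0) (xs ! 1) (xs ! 2) (xs ! 3) (xs ! 4))"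
  unfolding multilinear_def
proof (intro conjI allI impI assms(1))
  fix xs ys :: "'b list"
  assume "length xs + 1 + length ys = 5"
  then consider "length xs = 0" "length ys = 4" | "length xs = 1" "length ys = 3"
    | "length xs = 2" "length ys = 2" | "length xs = 3" "length ys = 1"
    | "length xs = 4" "length ys = 0" by linarith
  then show "Vector_Spaces.linear scale s (\<lambda>u. F ((xs @ u # ys) ! 0) ((xs @ u # ys) ! 1)
      ((xs @ u # ys) ! 2) ((xs @ u # ys) ! 3) ((xs @ u # ys) ! 4))"
    by cases (use assms in \<open>simp_all add: nth_append\<close>)
qed

lemma bilinear_map_list: "multilinear 2 s \<phi> \<Longrightarrow> bilinear_map s (\<lambda>u v. \<phi> [u, v])"
  using multilinearD[of 2 s \<phi> "[]"] multilinearD[of 2 s \<phi> "[_]" "[]"]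
  by (auto simp: bilinear_map_def)

lemma trilinear_map_list: "multilinear 3 s \<phi> \<Longrightarrow> trilinear_map s (\<lambda>u v w. \<phi> [u, v, w])"
  using multilinearD[of 3 s \<phi> "[]"] multilinearD[of 3 s \<phi> "[_]" "[_]"] multilinearD[of 3 s \<phi> "[_, _]" "[]"]
  by (auto simp: trilinear_map_def)

lemma multilinear_5_linear:
  assumes "multilinear 5 s \<phi>" "Vector_Spaces.linear scale scale g"
  shows "Vector_Spaces.linear scale s (\<lambda>u. \<phi> [g u, v, w, x, y])"
    and "Vector_Spaces.linear scale s (\<lambda>v. \<phi> [u, g v, w, x, y])"
    and "Vector_Spaces.linear scale s (\<lambda>w. \<phi> [u, v, g w, x, y])"
    and "Vector_Spaces.linear scale s (\<lambda>x. \<phi> [u, v, w, g x, y])"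
    and "Vector_Spaces.linear scale s (\<lambda>y. \<phi> [u, v, w, x, g y])"
  using linear_compose_app[OF multilinearD[OF assms(1), of "[]" "[v,w,x,y]"] assms(2)]
    linear_compose_app[OF multilinearD[OF assms(1), of "[u]" "[w,x,y]"] assms(2)]
    linear_compose_app[OF multilinearD[OF assms(1), of "[u,v]" "[x,y]"] assms(2)]
    linear_compose_app[OF multilinearD[OF assms(1), of "[u,v,w]" "[y]"] assms(2)]
    linear_compose_app[OF multilinearD[OF assms(1), of "[u,v,w,x]" "[]"] assms(2)]
  by auto

lemma tensor_sum_eq_sum2:
  assumes "X \<in> tensor_power 2"
  shows "tensor_sum s X F = sum2 s X (\<lambda>u v. F [u, v])"
  unfolding sum2_def
  by (rule tensor_sum_cong[OF assms]) (auto simp: numeral_2_eq_2 length_Suc_conv)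

lemma tensor_sum_eq_sum3:
  assumes "X \<in> tensor_power 3"
  shows "tensor_sum s X F = sum3 s X (\<lambda>u v w. F [u, v, w])"
  unfolding sum3_def
  by (rule tensor_sum_cong[OF assms]) (auto simp: numeral_3_eq_3 numeral_2_eq_2 length_Suc_conv)

lemma tensor_eval_eq_sum2:
  "X \<in> tensor_power 2 \<Longrightarrow> tensor_eval f X = sum2 scale X (\<lambda>u v. f [u, v])"
  by (simp add: tensor_sum_eq_sum2[symmetric] tensor_eval_def tensor_sum_def)

lemma linear_sum2_param:
  assumes "vector_space s" "X \<in> tensor_power 2" "\<And>a b. Vector_Spaces.linear scale s (\<lambda>u. F u a b)"
  shows "Vector_Spaces.linear scale s (\<lambda>u. sum2 s X (F u))"
  unfolding sum2_def by (rule linear_tensor_sum_param[OF assms(1,2)]) (rule assms(3))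

lemma linear_sum3_param:
  assumes "vector_space s" "X \<in> tensor_power 3" "\<And>a b c. Vector_Spaces.linear scale s (\<lambda>u. F u a b c)"
  shows "Vector_Spaces.linear scale s (\<lambda>u. sum3 s X (F u))"
  unfolding sum3_def by (rule linear_tensor_sum_param[OF assms(1,2)]) (rule assms(3))

lemma linear_sum2:
  assumes "linear_to_tensors 2 f" "bilinear_map s F" "Vector_Spaces.linear scale scale g"
  shows "Vector_Spaces.linear scale s (\<lambda>u. sum2 s (f (g u)) F)"
  using linear_compose_app[OF linear_tensor_sum[OF assms(1) multilinear_2[OF assms(2)]] assms(3)]
  by (simp add: sum2_def)

lemma linear_sum3:
  assumes "linear_to_tensors 3 f" "trilinear_map s F" "Vector_Spaces.linear scale scale g"
  shows "Vector_Spaces.linear scale s (\<lambda>u. sum3 s (f (g u)) F)"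
  using linear_compose_app[OF linear_tensor_sum[OF assms(1) multilinear_3[OF assms(2)]] assms(3)]
  by (simp add: sum3_def)

lemma linear_comp_sum2:
  "Vector_Spaces.linear s t T \<Longrightarrow> T (sum2 s X F) = sum2 t X (\<lambda>u v. T (F u v))"
  unfolding sum2_def by (rule linear_comp_tensor_sum)

lemma linear_comp_sum3:
  "Vector_Spaces.linear s t T \<Longrightarrow> T (sum3 s X F) = sum3 t X (\<lambda>u v w. T (F u v w))"
  unfolding sum3_def by (rule linear_comp_tensor_sum)

lemma sum2_swap:
  "vector_space s \<Longrightarrow> sum2 s X (\<lambda>u v. sum2 s Y (F u v)) = sum2 s Y (\<lambda>a b. sum2 s X (\<lambda>u v. F u v a b))"
  unfolding sum2_def by (rule tensor_sum_swap)

lemma sum2_add: "vector_space s \<Longrightarrow> sum2 s X (\<lambda>u v. F u v + G u v) = sum2 s X F + sum2 s X G"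
  unfolding sum2_def tensor_sum_def lin_ext_def
  by (simp add: sum.distrib vector_space_def)

lemma sum2_minus:
  assumes "vector_space s"
  shows "sum2 s X (\<lambda>u v. - F u v) = - sum2 s X F"
proof -
  interpret s: vector_space s by fact
  show ?thesis unfolding sum2_def tensor_sum_def lin_ext_def
    by (simp add: sum_negf)
qed

lemma sum2_scale:
  assumes "vector_space s"
  shows "s c (sum2 s X F) = sum2 s X (\<lambda>u v. s c (F u v))"
proof -
  interpret s: vector_space s by fact
  show ?thesis unfolding sum2_def tensor_sum_def lin_ext_def
    by (simp add: s.scale_sum_right mult.commute)
qed

lemma sum3_scale:
  assumes "vector_space s"
  shows "s c (sum3 s X F) = sum3 s X (\<lambda>u v w. s c (F u v w))"
proof -
  interpret s: vector_space s by fact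
  show ?thesis unfolding sum3_def tensor_sum_def lin_ext_def
    by (simp add: s.scale_sum_right mult.commute)
qed

lemma sum2_bilinear:
  assumes "X \<in> tensor_power 2" "Y \<in> tensor_power 2" "multilinear 2 s \<phi>"
  shows "tensor_sum s (tensor_of_bilinear [\<beta>, \<gamma>] X Y) \<phi> =
    sum2 s X (\<lambda>u v. sum2 s Y (\<lambda>a b. \<phi> [\<beta> u a, \<gamma> v b]))"
  using assms by (simp add: tensor_sum_bilinear tensor_sum_eq_sum2)

lemma sum3_bilinear:
  assumes "X \<in> tensor_power 3" "Y \<in> tensor_power 3" "multilinear 3 s \<phi>"
  shows "tensor_sum s (tensor_of_bilinear [\<beta>, \<gamma>, \<delta>] X Y) \<phi> =
    sum3 s X (\<lambda>u v w. sum3 s Y (\<lambda>a b c. \<phi> [\<beta> u a, \<gamma> v b, \<delta> w c]))"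
  using assms by (simp add: tensor_sum_bilinear tensor_sum_eq_sum3)

text \<open>An identity factor of \<open>tensor_of_maps\<close> enters through the chosen
  representative of \<open>pure [v]\<close>, which may differ from \<open>gen [v]\<close>. Linearity
  of \<open>F\<close> in that slot makes the difference invisible.\<close>

lemma tensor_sum_pure_append:
  assumes "multilinear n s F" "length xs + 1 + length ys = n"
  shows "tensor_sum s (pure [v]) (\<lambda>vs. F (xs @ vs @ ys)) = F (xs @ v # ys)"
proof -
  have "multilinear (1 + length ys) s (\<lambda>vs. F (xs @ vs))"
    using assms by (intro multilinear_append_left[of "length xs"]) (auto simp: add.assoc)
  then have "multilinear 1 s (\<lambda>vs. F (xs @ vs @ ys))"
    by (rule multilinear_append_right) simp
  then show ?thesis by (subst tensor_sum_pure) auto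
qed

lemma sum2_comult_left:
  assumes f: "linear_to_tensors 2 f" and X: "X \<in> tensor_power 2" and F: "multilinear 3 s F"
  shows "tensor_sum s (tensor_of_maps 3 [f, \<lambda>x. pure [x]] X) F =
    sum2 s X (\<lambda>u v. sum2 s (f u) (\<lambda>a b. F [a, b, v]))"
proof -
  have s: "vector_space s" using F by (rule multilinear_vector_space)
  have f2: "f u \<in> tensor_power 2" for u using f by (rule linear_to_tensors_power)
  show ?thesis unfolding tensor_of_maps_def
    using tensor_sum_pure_append[OF F, of "[_, _]" "[]"]
    by (simp add: tensor_sum_map[OF F] tensor_sum_eq_sum2[OF X] lin_ext_juxtapose_rep[OF s]
        lin_ext_gen[OF s] tensor_sum_eq_sum2[OF f2])
qed

lemma sum2_comult_right:
  assumes f: "linear_to_tensors 2 f" and X: "X \<in> tensor_power 2" and F: "multilinear 3 s F"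
  shows "tensor_sum s (tensor_of_maps 3 [\<lambda>x. pure [x], f] X) F =
    sum2 s X (\<lambda>u v. sum2 s (f v) (\<lambda>a b. F [u, a, b]))"
proof -
  have s: "vector_space s" using F by (rule multilinear_vector_space)
  have f2: "f u \<in> tensor_power 2" for u using f by (rule linear_to_tensors_power)
  \<comment> \<open>The sum over \<open>pure [u]\<close> is the outer one here; only after the swap
    are the other two entries fixed, so that it collapses.\<close>
  have *: "tensor_sum s (pure [u]) (\<lambda>us. sum2 s (f v) (\<lambda>a b. F (us @ [a, b]))) =
      sum2 s (f v) (\<lambda>a b. F [u, a, b])" for u v
    unfolding sum2_def
    by (subst tensor_sum_swap[OF s]) (use tensor_sum_pure_append[OF F, of "[]" "[_, _]"] in simp)
  show ?thesis unfolding tensor_of_maps_def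
    by (simp add: tensor_sum_map[OF F] tensor_sum_eq_sum2[OF X] lin_ext_juxtapose_rep[OF s]
        lin_ext_gen[OF s] tensor_sum_eq_sum2[OF f2] *)
qed

lemma sum3_hg_left:
  assumes f: "linear_to_tensors 3 f" and X: "X \<in> tensor_power 3" and F: "multilinear 5 s F"
  shows "tensor_sum s (tensor_of_maps 5 [f, \<lambda>x. pure [x], \<lambda>x. pure [x]] X) F =
    sum3 s X (\<lambda>u v w. sum3 s (f u) (\<lambda>a b c. F [a, b, c, v, w]))"
proof -
  have s: "vector_space s" using F by (rule multilinear_vector_space)
  have f3: "f u \<in> tensor_power 3" for u using f by (rule linear_to_tensors_power)
  have *: "tensor_sum s (pure [v]) (\<lambda>vs. tensor_sum s (pure [w]) (\<lambda>ws. F (a # b # c # vs @ ws))) =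
      F [a, b, c, v, w]" for a b c v w
  proof -
    have "tensor_sum s (pure [v]) (\<lambda>vs. tensor_sum s (pure [w]) (\<lambda>ws. F (a # b # c # vs @ ws))) =
        tensor_sum s (pure [v]) (\<lambda>vs. F (a # b # c # vs @ [w]))"
    \<comment> \<open>The inner sum collapses only if \<open>vs\<close> has length 1, which the
      support of a representative of \<open>pure [v]\<close> guarantees.\<close>
    proof (rule tensor_sum_cong[OF pure_tensor_power])
      show "tensor_sum s (pure [w]) (\<lambda>ws. F (a # b # c # vs @ ws)) = F (a # b # c # vs @ [w])"
        if "length vs = length [v]" for vs
        using that tensor_sum_pure_append[OF F, of "a # b # c # vs" "[]" w] by simp
    qed simp
    then show ?thesis using tensor_sum_pure_append[OF F, of "[a, b, c]" "[w]" v] by simp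
  qed
  show ?thesis unfolding tensor_of_maps_def
    by (simp add: tensor_sum_map[OF F] tensor_sum_eq_sum3[OF X] lin_ext_juxtapose_rep[OF s]
        lin_ext_gen[OF s] tensor_sum_eq_sum3[OF f3] *)
qed

lemma sum3_hg_right:
  assumes f: "linear_to_tensors 3 f" and X: "X \<in> tensor_power 3" and F: "multilinear 5 s F"
  shows "tensor_sum s (tensor_of_maps 5 [\<lambda>x. pure [x], \<lambda>x. pure [x], f] X) F =
    sum3 s X (\<lambda>u v w. sum3 s (f w) (\<lambda>a b c. F [u, v, a, b, c]))"
proof -
  have s: "vector_space s" using F by (rule multilinear_vector_space)
  have f3: "f u \<in> tensor_power 3" for u using f by (rule linear_to_tensors_power)
  have *: "tensor_sum s (pure [u]) (\<lambda>us. tensor_sum s (pure [v]) (\<lambda>vs.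
        sum3 s (f w) (\<lambda>a b c. F (us @ vs @ [a, b, c])))) =
      sum3 s (f w) (\<lambda>a b c. F [u, v, a, b, c])" for u v w
  proof -
    have "tensor_sum s (pure [u]) (\<lambda>us. tensor_sum s (pure [v]) (\<lambda>vs.
          sum3 s (f w) (\<lambda>a b c. F (us @ vs @ [a, b, c])))) =
        tensor_sum s (pure [u]) (\<lambda>us. sum3 s (f w) (\<lambda>a b c. F (us @ v # [a, b, c])))"
      unfolding sum3_def
    proof (rule tensor_sum_cong[OF pure_tensor_power])
      show "tensor_sum s (pure [v]) (\<lambda>vs. tensor_sum s (f w) (\<lambda>xs. F (us @ vs @ [xs ! 0, xs ! 1, xs ! 2]))) =
          tensor_sum s (f w) (\<lambda>xs. F (us @ v # [xs ! 0, xs ! 1, xs ! 2]))"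
        if "length us = length [u]" for us
        by (subst tensor_sum_swap[OF s])
          (use that tensor_sum_pure_append[OF F, of us "[_, _, _]" v] in simp)
    qed simp
    also have "\<dots> = sum3 s (f w) (\<lambda>a b c. F [u, v, a, b, c])"
      unfolding sum3_def
      by (subst tensor_sum_swap[OF s]) (use tensor_sum_pure_append[OF F, of "[]" "[_, _, _, _]" u] in simp)
    finally show ?thesis .
  qed
  show ?thesis unfolding tensor_of_maps_def
    by (simp add: tensor_sum_map[OF F] tensor_sum_eq_sum3[OF X] lin_ext_juxtapose_rep[OF s]
        lin_ext_gen[OF s] tensor_sum_eq_sum3[OF f3] *)
qed

end

section \<open>Hopf and Hopf-Galois axioms in Sweedler form\<close>

context k_algebra
begin

lemma linear_mult_const:
  "Vector_Spaces.linear r scale f \<Longrightarrow> Vector_Spaces.linear r scale (\<lambda>u. f u * y)"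
  unfolding linear_iff by (simp add: scale_mult_left distrib_right)

lemma linear_const_mult:
  "Vector_Spaces.linear r scale f \<Longrightarrow> Vector_Spaces.linear r scale (\<lambda>u. y * f u)"
  unfolding linear_iff by (simp add: scale_mult_right distrib_left)

lemma linear_id: "Vector_Spaces.linear scale scale (\<lambda>u. u)"
  unfolding linear_iff by (simp add: vector_space_axioms)

text \<open>The start of a growing collection of introduction rules that proves linearity of an
  integrand by descending through its structure. The extended versions below discharge the side
  conditions of the Sweedler rules.\<close>

lemmas linear_intros =
  linear_id linear_mult_const linear_const_mult linear_scale_const linear_const_scale
  vector_space_mult vector_space_axioms

lemma character_linear:
  "character \<alpha> \<Longrightarrow> Vector_Spaces.linear scale scale g \<Longrightarrow> Vector_Spaces.linear scale (*) (\<lambda>u. \<alpha> (g u))"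
  unfolding character_def by (blast intro: linear_compose_app)

text \<open>By separation, the axioms that equate tensors need to be tested on scalar-valued
  multilinear maps only. The counit and antipode axioms equate elements of the algebra, so they keep
  values there.\<close>

lemma hopf_algebraI:
  assumes lin: "linear_to_tensors 2 \<Delta>"
    and one: "\<And>F. bilinear_map (*) F \<Longrightarrow> sum2 (*) (\<Delta> 1) F = F 1 1"
    and mult: "\<And>F x y. bilinear_map (*) F \<Longrightarrow> sum2 (*) (\<Delta> (x * y)) F =
      sum2 (*) (\<Delta> x) (\<lambda>u v. sum2 (*) (\<Delta> y) (\<lambda>a b. F (u * a) (v * b)))"
    and counit: "character \<epsilon>"
    and coassoc: "\<And>F x. trilinear_map (*) F \<Longrightarrow>
      sum2 (*) (\<Delta> x) (\<lambda>u v. sum2 (*) (\<Delta> u) (\<lambda>a b. F a b v)) =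
      sum2 (*) (\<Delta> x) (\<lambda>u v. sum2 (*) (\<Delta> v) (\<lambda>a b. F u a b))"
    and counit_left: "\<And>x. sum2 scale (\<Delta> x) (\<lambda>u v. scale (\<epsilon> u) v) = x"
    and counit_right: "\<And>x. sum2 scale (\<Delta> x) (\<lambda>u v. scale (\<epsilon> v) u) = x"
    and antipode: "Vector_Spaces.linear scale scale S"
    and antipode_left: "\<And>x. sum2 scale (\<Delta> x) (\<lambda>u v. S u * v) = scale (\<epsilon> x) 1"
    and antipode_right: "\<And>x. sum2 scale (\<Delta> x) (\<lambda>u v. u * S v) = scale (\<epsilon> x) 1"
  shows "hopf_algebra scale \<Delta> \<epsilon> S"
proof (unfold_locales, goal_cases)
  have power: "\<Delta> x \<in> tensor_power 2" for x using lin by (rule linear_to_tensors_power)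
  note power_class = tensor_power_class[OF power]
  note sum2_eq = tensor_sum_eq_sum2[OF power] tensor_eval_eq_sum2[OF power]
  {
    case 2
    show ?case
      by (rule tensor_eqI[OF power_class tensor_ops_class(7)])
        (simp_all add: sum2_eq tensor_sum_pure one[OF bilinear_map_list])
  next
    case (3 x y)
    show ?case
      by (rule tensor_eqI[OF power_class tensor_ops_class(6)])
        (simp_all add: sum2_eq sum2_bilinear[OF power power] mult[OF bilinear_map_list])
  next
    case (5 x)
    show ?case
      by (rule tensor_eqI[OF tensor_ops_class(5) tensor_ops_class(5)])
        (simp add: sum2_comult_left[OF lin power] sum2_comult_right[OF lin power]
          coassoc[OF trilinear_map_list])
  }
qed (use assms in \<open>simp_all add: tensor_eval_eq_sum2[OF linear_to_tensors_power[OF lin]] linear_iff\<close>)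

lemma hopf_galois_algebraI:
  assumes lin: "linear_to_tensors 3 \<mu>"
    and one: "\<And>F. trilinear_map (*) F \<Longrightarrow> sum3 (*) (\<mu> 1) F = F 1 1 1"
    and mult: "\<And>F x y. trilinear_map (*) F \<Longrightarrow> sum3 (*) (\<mu> (x * y)) F =
      sum3 (*) (\<mu> x) (\<lambda>u v w. sum3 (*) (\<mu> y) (\<lambda>a b c. F (u * a) (b * v) (w * c)))"
    and coassoc: "\<And>\<phi> x. multilinear 5 (*) \<phi> \<Longrightarrow>
      sum3 (*) (\<mu> x) (\<lambda>u v w. sum3 (*) (\<mu> u) (\<lambda>a b c. \<phi> [a, b, c, v, w])) =
      sum3 (*) (\<mu> x) (\<lambda>u v w. sum3 (*) (\<mu> w) (\<lambda>a b c. \<phi> [u, v, a, b, c]))"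
    and left: "\<And>F x. bilinear_map (*) F \<Longrightarrow> sum3 (*) (\<mu> x) (\<lambda>u v w. F (u * v) w) = F 1 x"
    and right: "\<And>F x. bilinear_map (*) F \<Longrightarrow> sum3 (*) (\<mu> x) (\<lambda>u v w. F u (v * w)) = F x 1"
  shows "hopf_galois_algebra scale \<mu>"
proof (unfold_locales, goal_cases)
  have power: "\<mu> x \<in> tensor_power 3" for x using lin by (rule linear_to_tensors_power)
  note power_class = tensor_power_class[OF power]
  {
    case 1
    show ?case by (rule lin)
  next
    case 2
    show ?case
      by (rule tensor_eqI[OF power_class tensor_ops_class(7)])
        (simp_all add: tensor_sum_eq_sum3[OF power] tensor_sum_pure one[OF trilinear_map_list])
  next
    case (3 x y)
    show ?case
      by (rule tensor_eqI[OF power_class tensor_ops_class(6)])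
        (simp_all add: tensor_sum_eq_sum3[OF power] sum3_bilinear[OF power power] mult[OF trilinear_map_list])
  next
    case (4 x)
    show ?case
      by (rule tensor_eqI[OF tensor_ops_class(5) tensor_ops_class(5)])
        (simp add: sum3_hg_left[OF lin power] sum3_hg_right[OF lin power] coassoc)
  next
    case (5 x)
    show ?case
      by (rule tensor_eqI[OF tensor_ops_class(4) tensor_ops_class(7)])
        (simp_all add: tensor_sum_map tensor_sum_eq_sum3[OF power] tensor_sum_pure
          lin_ext_gen[OF vector_space_mult] left[OF bilinear_map_list])
  next
    case (6 x)
    show ?case
      by (rule tensor_eqI[OF tensor_ops_class(4) tensor_ops_class(7)])
        (simp_all add: tensor_sum_map tensor_sum_eq_sum3[OF power] tensor_sum_pure
          lin_ext_gen[OF vector_space_mult] right[OF bilinear_map_list])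
  }
qed

end

section \<open>Sweedler rules for given structures, with values in any vector space\<close>

context hopf_algebra
begin

lemma comult_power: "\<Delta> x \<in> tensor_power 2"
  using comult_linear by (rule linear_to_tensors_power)

lemma sum2_comult_one: "bilinear_map s F \<Longrightarrow> sum2 s (\<Delta> 1) F = F 1 1"
  using tensor_sum_pure[OF multilinear_2, of s F "[1, 1]"] by (simp add: sum2_def comult_one)

lemma sum2_comult_mult:
  assumes "bilinear_map s F"
  shows "sum2 s (\<Delta> (x * y)) F =
    sum2 s (\<Delta> x) (\<lambda>u v. sum2 s (\<Delta> y) (\<lambda>a b. F (u * a) (v * b)))"
  using sum2_bilinear[OF comult_power[of x] comult_power[of y] multilinear_2[OF assms],
      where \<beta> = "(*)" and \<gamma> = "(*)"]
  by (simp add: comult_mult[symmetric] sum2_def)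

lemma sum2_coassoc:
  assumes "trilinear_map s F"
  shows "sum2 s (\<Delta> x) (\<lambda>u v. sum2 s (\<Delta> u) (\<lambda>a b. F a b v)) =
    sum2 s (\<Delta> x) (\<lambda>u v. sum2 s (\<Delta> v) (\<lambda>a b. F u a b))"
  using sum2_comult_left[OF comult_linear comult_power multilinear_3[OF assms], of x]
    sum2_comult_right[OF comult_linear comult_power multilinear_3[OF assms], of x]
  by (simp add: coassoc)

lemma sum2_counit_left:
  assumes "Vector_Spaces.linear scale s T"
  shows "sum2 s (\<Delta> x) (\<lambda>u v. s (\<epsilon> u) (T v)) = T x"
  using linear_comp_sum2[OF assms, of "\<Delta> x" "\<lambda>u v. scale (\<epsilon> u) v"] assms counit_left[of x]
  by (simp add: tensor_eval_eq_sum2[OF comult_power] linear_iff)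

lemma sum2_counit_right:
  assumes "Vector_Spaces.linear scale s T"
  shows "sum2 s (\<Delta> x) (\<lambda>u v. s (\<epsilon> v) (T u)) = T x"
  using linear_comp_sum2[OF assms, of "\<Delta> x" "\<lambda>u v. scale (\<epsilon> v) u"] assms counit_right[of x]
  by (simp add: tensor_eval_eq_sum2[OF comult_power] linear_iff)

lemma sum2_antipode_left: "sum2 scale (\<Delta> x) (\<lambda>u v. S u * v) = scale (\<epsilon> x) 1"
  using antipode_left[of x] by (simp add: tensor_eval_eq_sum2[OF comult_power])

lemma sum2_antipode_right: "sum2 scale (\<Delta> x) (\<lambda>u v. u * S v) = scale (\<epsilon> x) 1"
  using antipode_right[of x] by (simp add: tensor_eval_eq_sum2[OF comult_power])

end

context hopf_galois_algebra
begin

lemma hg_power: "\<mu> x \<in> tensor_power 3"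
  using hg_linear by (rule linear_to_tensors_power)

lemma sum3_hg_one: "trilinear_map s F \<Longrightarrow> sum3 s (\<mu> 1) F = F 1 1 1"
  using tensor_sum_pure[OF multilinear_3, of s F "[1, 1, 1]"] by (simp add: sum3_def hg_one)

lemma sum3_hg_mult:
  assumes "trilinear_map s F"
  shows "sum3 s (\<mu> (x * y)) F =
    sum3 s (\<mu> x) (\<lambda>u v w. sum3 s (\<mu> y) (\<lambda>a b c. F (u * a) (b * v) (w * c)))"
  using sum3_bilinear[OF hg_power[of x] hg_power[of y] multilinear_3[OF assms],
      where \<beta> = "(*)" and \<gamma> = "\<lambda>u v. v * u" and \<delta> = "(*)"]
  by (simp add: hg_mult[symmetric] sum3_def)

lemma sum3_hg_coassoc:
  assumes "multilinear 5 s \<phi>"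
  shows "sum3 s (\<mu> x) (\<lambda>u v w. sum3 s (\<mu> u) (\<lambda>a b c. \<phi> [a, b, c, v, w])) =
    sum3 s (\<mu> x) (\<lambda>u v w. sum3 s (\<mu> w) (\<lambda>a b c. \<phi> [u, v, a, b, c]))"
  using sum3_hg_left[OF hg_linear hg_power assms, of x] sum3_hg_right[OF hg_linear hg_power assms, of x]
  by (simp add: hg_coassoc)

text \<open>With the integrand as a function of five variables, unification can read it off a goal;
  an integrand on lists could not be found that way.\<close>

lemma sum3_hg_coassoc_curried:
  assumes "vector_space s"
    and "\<And>v w x y. Vector_Spaces.linear scale s (\<lambda>u. F u v w x y)"
    and "\<And>u w x y. Vector_Spaces.linear scale s (\<lambda>v. F u v w x y)"
    and "\<And>u v x y. Vector_Spaces.linear scale s (\<lambda>w. F u v w x y)"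
    and "\<And>u v w y. Vector_Spaces.linear scale s (\<lambda>x. F u v w x y)"
    and "\<And>u v w x. Vector_Spaces.linear scale s (\<lambda>y. F u v w x y)"
  shows "sum3 s (\<mu> x) (\<lambda>u v w. sum3 s (\<mu> u) (\<lambda>a b c. F a b c v w)) =
    sum3 s (\<mu> x) (\<lambda>u v w. sum3 s (\<mu> w) (\<lambda>a b c. F u v a b c))"
  using sum3_hg_coassoc[OF multilinear_5[of s F], of x] assms by simp

lemma sum3_hg_left_unit:
  assumes "bilinear_map s F"
  shows "sum3 s (\<mu> x) (\<lambda>u v w. F (u * v) w) = F 1 x"
proof -
  have s: "vector_space s" using assms by (rule bilinear_map_vector_space)
  show ?thesis
    using tensor_sum_map[OF multilinear_2[OF assms], of _ "\<mu> x"] tensor_sum_pure[OF multilinear_2[OF assms], of "[1, x]"]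
    by (simp add: hg_left[symmetric] tensor_sum_eq_sum3[OF hg_power] lin_ext_gen[OF s])
qed

lemma sum3_hg_right_unit:
  assumes "bilinear_map s F"
  shows "sum3 s (\<mu> x) (\<lambda>u v w. F u (v * w)) = F x 1"
proof -
  have s: "vector_space s" using assms by (rule bilinear_map_vector_space)
  show ?thesis
    using tensor_sum_map[OF multilinear_2[OF assms], of _ "\<mu> x"] tensor_sum_pure[OF multilinear_2[OF assms], of "[x, 1]"]
    by (simp add: hg_right[symmetric] tensor_sum_eq_sum3[OF hg_power] lin_ext_gen[OF s])
qed

end

context poisson_algebra
begin

lemma br_linear:
  assumes "Vector_Spaces.linear r scale g"
  shows "Vector_Spaces.linear r scale (\<lambda>u. br (g u) y)" "Vector_Spaces.linear r scale (\<lambda>u. br x (g u))"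
  using linear_compose_app[OF br_linear_left assms] linear_compose_app[OF br_linear_right assms] by auto

lemma br_bilinear: "bilinear_map scale br"
  by (intro bilinear_mapI br_linear_left br_linear_right)

lemma br_scale: "br (scale c x) y = scale c (br x y)" "br x (scale c y) = scale c (br x y)"
  using br_linear_left[of y] br_linear_right[of x] by (auto simp: linear_iff)

lemma br_antisym: "br y x = - br x y"
proof -
  have "0 = br (x + y) (x + y)" by (simp add: br_alternating)
  also have "\<dots> = br x x + br x y + (br y x + br y y)"
    using br_linear_left[of "x + y"] br_linear_right[of x] br_linear_right[of y]
    by (simp add: linear_iff)
  finally show ?thesis by (simp add: br_alternating eq_neg_iff_add_eq_0 add.commute)
qed

text \<open>The Leibniz rule for \<open>1 * 1\<close> gives
  \<open>br x 1 = br x 1 + br x 1\<close>.\<close>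

lemma br_one: "br x 1 = 0" "br 1 x = 0"
  using br_leibniz[of x 1 1] br_antisym[of x 1] by auto

lemma sum2_br_tensor2:
  assumes "X \<in> tensor_power 2" "Y \<in> tensor_power 2" "multilinear 2 s \<phi>"
  shows "tensor_sum s (br_tensor2 X Y) \<phi> =
    sum2 s X (\<lambda>u v. sum2 s Y (\<lambda>a b. \<phi> [u * a, br v b])) +
    sum2 s X (\<lambda>u v. sum2 s Y (\<lambda>a b. \<phi> [br u a, v * b]))"
  using assms by (simp add: br_tensor2_def tensor_sum_add sum2_bilinear)

lemma sum3_br_tensor3:
  assumes "X \<in> tensor_power 3" "Y \<in> tensor_power 3" "multilinear 3 s \<phi>"
  shows "tensor_sum s (br_tensor3 X Y) \<phi> =
    sum3 s X (\<lambda>u v w. sum3 s Y (\<lambda>a b c. \<phi> [br u a, v * b, w * c])) -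
    sum3 s X (\<lambda>u v w. sum3 s Y (\<lambda>a b c. \<phi> [u * a, br v b, w * c])) +
    sum3 s X (\<lambda>u v w. sum3 s Y (\<lambda>a b c. \<phi> [u * a, v * b, br w c]))"
  using assms by (simp add: br_tensor3_def tensor_sum_add tensor_sum_diff sum3_bilinear)

end

context poisson_hopf_algebra
begin

lemma sum2_comult_br:
  assumes "bilinear_map s F"
  shows "sum2 s (\<Delta> (br x y)) F =
    sum2 s (\<Delta> x) (\<lambda>u v. sum2 s (\<Delta> y) (\<lambda>a b. F (u * a) (br v b))) +
    sum2 s (\<Delta> x) (\<lambda>u v. sum2 s (\<Delta> y) (\<lambda>a b. F (br u a) (v * b)))"
  using sum2_br_tensor2[OF comult_power[of x] comult_power[of y] multilinear_2[OF assms]]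
  by (simp add: comult_br[symmetric] sum2_def)

end

context poisson_hopf_galois_algebra
begin

lemma sum3_hg_br:
  assumes "trilinear_map s F"
  shows "sum3 s (\<mu> (br x y)) F =
    sum3 s (\<mu> x) (\<lambda>u v w. sum3 s (\<mu> y) (\<lambda>a b c. F (br u a) (v * b) (w * c))) -
    sum3 s (\<mu> x) (\<lambda>u v w. sum3 s (\<mu> y) (\<lambda>a b c. F (u * a) (br v b) (w * c))) +
    sum3 s (\<mu> x) (\<lambda>u v w. sum3 s (\<mu> y) (\<lambda>a b c. F (u * a) (v * b) (br w c)))"
  using sum3_br_tensor3[OF hg_power[of x] hg_power[of y] multilinear_3[OF assms]]
  by (simp add: hg_br[symmetric] sum3_def)

end

section \<open>From Hopf-Galois to Hopf\<close>

locale hopf_galois_character = hopf_galois_algebra scale \<mu>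
  for scale :: "'k::field \<Rightarrow> 'a::ring_1 \<Rightarrow> 'a" and \<mu> +
  fixes \<alpha> :: "'a \<Rightarrow> 'k"
  assumes character: "character \<alpha>"
begin

definition comult :: "'a \<Rightarrow> ('a list \<Rightarrow>\<^sub>0 'k) set" where
  "comult x = tensor_map 2 (\<lambda>xs. free_scale (\<alpha> (xs ! 1)) (gen [xs ! 0, xs ! 2])) (\<mu> x)"

definition antipode :: "'a \<Rightarrow> 'a" where
  "antipode x = sum3 scale (\<mu> x) (\<lambda>u v w. scale (\<alpha> u * \<alpha> w) v)"

lemma character_simps [simp]: "\<alpha> 1 = 1" "\<alpha> (x * y) = \<alpha> x * \<alpha> y"
  using character by (auto simp: character_def)

lemmas hg_linear_intros = linear_intros character_linear[OF character]
  linear_sum3[OF hg_linear] linear_sum3_param[OF _ hg_power] bilinear_mapI trilinear_mapI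

lemma comult_power: "comult x \<in> tensor_power 2"
  unfolding comult_def
  by (rule tensor_map_power[OF hg_power]) (auto simp: in_keys_iff lookup_single when_def split: if_splits)

lemma tensor_sum_comult:
  assumes "multilinear 2 s \<phi>"
  shows "tensor_sum s (comult x) \<phi> = sum3 s (\<mu> x) (\<lambda>u v w. s (\<alpha> v) (\<phi> [u, w]))"
proof -
  have s: "vector_space s" using assms by (rule multilinear_vector_space)
  interpret L: Vector_Spaces.linear free_scale s "lin_ext s \<phi>" using s by (rule linear_lin_ext)
  show ?thesis
    by (simp add: comult_def tensor_sum_map[OF assms] L.scale lin_ext_gen[OF s] sum3_def)
qed

lemma sum2_comult:
  "bilinear_map s F \<Longrightarrow> sum2 s (comult x) F = sum3 s (\<mu> x) (\<lambda>u v w. s (\<alpha> v) (F u w))"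
  unfolding sum2_def by (subst tensor_sum_comult[OF multilinear_2]) simp_all

lemma comult_linear: "linear_to_tensors 2 comult"
proof (rule linear_to_tensorsI[OF comult_power])
  fix \<phi> assume "multilinear 2 ((*) :: 'k \<Rightarrow> 'k \<Rightarrow> 'k) \<phi>"
  note \<phi> = this bilinear_map_linear[OF bilinear_map_list[OF this]]
  show "Vector_Spaces.linear scale (*) (\<lambda>x. tensor_sum (*) (comult x) \<phi>)"
    unfolding tensor_sum_comult[OF \<phi>(1)] by (intro hg_linear_intros \<phi>(2,3))
qed

lemmas comult_linear_intros = hg_linear_intros linear_sum2[OF comult_linear] linear_sum2_param[OF _ comult_power]

lemma antipode_linear: "Vector_Spaces.linear scale scale antipode"
  unfolding antipode_def[abs_def] by (intro hg_linear_intros)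

lemma antipode_linear_app:
  "Vector_Spaces.linear scale scale g \<Longrightarrow> Vector_Spaces.linear scale scale (\<lambda>u. antipode (g u))"
  by (rule linear_compose_app[OF antipode_linear])

text \<open>This is coassociativity of \<open>\<mu>\<close> with \<open>\<alpha>\<close> applied to
  the second and fourth of the five factors.\<close>

lemma comult_coassoc:
  fixes F :: "'a \<Rightarrow> 'a \<Rightarrow> 'a \<Rightarrow> 'k"
  assumes "trilinear_map (*) F"
  shows "sum2 (*) (comult x) (\<lambda>u v. sum2 (*) (comult u) (\<lambda>a b. F a b v)) =
      sum2 (*) (comult x) (\<lambda>u v. sum2 (*) (comult v) (\<lambda>a b. F u a b))"
proof -
  note F = trilinear_map_linear[OF assms]
  have inner: "sum2 (*) (comult u) (\<lambda>a b. F a b v) = sum3 (*) (\<mu> u) (\<lambda>a b c. \<alpha> b * F a c v)"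
    "sum2 (*) (comult v) (\<lambda>a b. F u a b) = sum3 (*) (\<mu> v) (\<lambda>a b c. \<alpha> b * F u a c)" for u v
    by (intro sum2_comult comult_linear_intros F)+
  have "sum2 (*) (comult x) (\<lambda>u v. sum2 (*) (comult u) (\<lambda>a b. F a b v)) =
      sum3 (*) (\<mu> x) (\<lambda>u v w. \<alpha> v * sum3 (*) (\<mu> u) (\<lambda>a b c. \<alpha> b * F a c w))"
    unfolding inner by (intro sum2_comult comult_linear_intros F)
  also have "\<dots> = sum3 (*) (\<mu> x) (\<lambda>u v w. sum3 (*) (\<mu> u) (\<lambda>a b c. \<alpha> v * (\<alpha> b * F a c w)))"
    by (simp only: sum3_scale[OF vector_space_mult])
  also have "\<dots> = sum3 (*) (\<mu> x) (\<lambda>u v w. sum3 (*) (\<mu> w) (\<lambda>a b c. \<alpha> b * (\<alpha> v * F u a c)))"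
    by (rule sum3_hg_coassoc_curried) (intro hg_linear_intros F)+
  also have "\<dots> = sum3 (*) (\<mu> x) (\<lambda>u v w. \<alpha> v * sum3 (*) (\<mu> w) (\<lambda>a b c. \<alpha> b * F u a c))"
    by (simp only: sum3_scale[OF vector_space_mult] mult.left_commute)
  also have "\<dots> = sum2 (*) (comult x) (\<lambda>u v. sum2 (*) (comult v) (\<lambda>a b. F u a b))"
    unfolding inner by (rule sum2_comult[symmetric]) (intro comult_linear_intros F)
  finally show ?thesis .
qed

text \<open>Among the five factors of the iterated \<open>\<mu>\<close>, the first, third and fourth
  go into \<open>\<alpha>\<close> and the second is multiplied with the fifth. Coassociativity makes
  the third and fourth the first two factors of the inner \<open>\<mu>\<close>. Since
  \<open>\<alpha>\<close> is multiplicative, they meet as a product and the left unit axiom removes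
  them; the right unit axiom then handles the outer \<open>\<mu>\<close>.\<close>

lemma comult_antipode_left: "sum2 scale (comult x) (\<lambda>u v. antipode u * v) = scale (\<alpha> x) 1"
proof -
  have "sum2 scale (comult x) (\<lambda>u v. antipode u * v) =
      sum3 scale (\<mu> x) (\<lambda>u v w. scale (\<alpha> v) (antipode u * w))"
    by (intro sum2_comult hg_linear_intros antipode_linear_app)
  also have "\<dots> = sum3 scale (\<mu> x) (\<lambda>u v w. sum3 scale (\<mu> u) (\<lambda>a b c.
      scale (\<alpha> v) (scale (\<alpha> a * \<alpha> c) b * w)))"
    unfolding antipode_def
    \<comment> \<open>The sum defining the antipode moves out through a linear map; the dummies
      stand for expressions in the bound variables of the outer sum.\<close>
    by (subst linear_comp_sum3[of scale scale "\<lambda>z. scale _ (z * _)"]) (intro hg_linear_intros, rule refl)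
  also have "\<dots> = sum3 scale (\<mu> x) (\<lambda>u v w. sum3 scale (\<mu> w) (\<lambda>a b c.
      scale (\<alpha> b) (scale (\<alpha> u * \<alpha> a) v * c)))"
    by (rule sum3_hg_coassoc_curried) (intro hg_linear_intros)+
  also have "\<dots> = sum3 scale (\<mu> x) (\<lambda>u v w. sum3 scale (\<mu> w) (\<lambda>a b c.
      scale (\<alpha> u * \<alpha> (a * b)) (v * c)))"
    by (simp add: scale_mult_left mult_ac)
  also have "\<dots> = sum3 scale (\<mu> x) (\<lambda>u v w. scale (\<alpha> u * \<alpha> 1) (v * w))"
    by (subst sum3_hg_left_unit[where F = "\<lambda>p c. scale (_ * \<alpha> p) (_ * c)"]) (intro hg_linear_intros, rule refl)
  also have "\<dots> = scale (\<alpha> x) 1"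
    using sum3_hg_right_unit[of scale "\<lambda>u p. scale (\<alpha> u) p" x]
    by (simp add: hg_linear_intros)
  finally show ?thesis .
qed

text \<open>The mirror image: \<open>\<alpha>\<close> takes the second, third and fifth factors and
  the first is multiplied with the fourth, so the right unit axiom acts on the inner
  \<open>\<mu>\<close> and the left one on the outer.\<close>

lemma comult_antipode_right: "sum2 scale (comult x) (\<lambda>u v. u * antipode v) = scale (\<alpha> x) 1"
proof -
  have "sum2 scale (comult x) (\<lambda>u v. u * antipode v) =
      sum3 scale (\<mu> x) (\<lambda>u v w. scale (\<alpha> v) (u * antipode w))"
    by (intro sum2_comult hg_linear_intros antipode_linear_app)
  also have "\<dots> = sum3 scale (\<mu> x) (\<lambda>u v w. sum3 scale (\<mu> w) (\<lambda>a b c.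
      scale (\<alpha> v) (u * scale (\<alpha> a * \<alpha> c) b)))"
    unfolding antipode_def
    by (subst linear_comp_sum3[of scale scale "\<lambda>z. scale _ (_ * z)"]) (intro hg_linear_intros, rule refl)
  also have "\<dots> = sum3 scale (\<mu> x) (\<lambda>u v w. sum3 scale (\<mu> u) (\<lambda>a b c.
      scale (\<alpha> b) (a * scale (\<alpha> c * \<alpha> w) v)))"
    by (rule sum3_hg_coassoc_curried[symmetric]) (intro hg_linear_intros)+
  also have "\<dots> = sum3 scale (\<mu> x) (\<lambda>u v w. sum3 scale (\<mu> u) (\<lambda>a b c.
      scale (\<alpha> (b * c) * \<alpha> w) (a * v)))"
    by (simp add: scale_mult_right mult_ac)
  also have "\<dots> = sum3 scale (\<mu> x) (\<lambda>u v w. scale (\<alpha> 1 * \<alpha> w) (u * v))"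
    by (subst sum3_hg_right_unit[where F = "\<lambda>a p. scale (\<alpha> p * _) (a * _)"]) (intro hg_linear_intros, rule refl)
  also have "\<dots> = scale (\<alpha> x) 1"
    using sum3_hg_left_unit[of scale "\<lambda>p w. scale (\<alpha> w) p" x]
    by (simp add: hg_linear_intros)
  finally show ?thesis .
qed

lemma hopf_algebra_comult: "hopf_algebra scale comult \<alpha> antipode"
proof (rule hopf_algebraI[OF comult_linear _ _ character comult_coassoc _ _ antipode_linear
    comult_antipode_left comult_antipode_right])
  fix F :: "'a \<Rightarrow> 'a \<Rightarrow> 'k" assume F: "bilinear_map (*) F"
  note F_linear = bilinear_map_linear[OF F]
  show "sum2 (*) (comult 1) F = F 1 1"
    by (subst sum2_comult[OF F], subst sum3_hg_one) (intro hg_linear_intros F_linear, simp)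
  show "sum2 (*) (comult (x * y)) F =
      sum2 (*) (comult x) (\<lambda>u v. sum2 (*) (comult y) (\<lambda>a b. F (u * a) (v * b)))" for x y
  proof -
    have inner: "sum2 (*) (comult y) (\<lambda>a b. F (u * a) (v * b)) =
        sum3 (*) (\<mu> y) (\<lambda>a b c. \<alpha> b * F (u * a) (v * c))" for u v
      by (intro sum2_comult hg_linear_intros F_linear)
    have "sum2 (*) (comult (x * y)) F = sum3 (*) (\<mu> x) (\<lambda>u v w. sum3 (*) (\<mu> y) (\<lambda>a b c.
        \<alpha> (b * v) * F (u * a) (w * c)))"
      by (subst sum2_comult[OF F], subst sum3_hg_mult) (intro hg_linear_intros F_linear, rule refl)
    \<comment> \<open>The reversed product of the opposite factor does no harm, since the values of
      \<open>\<alpha>\<close> commute.\<close>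
    also have "\<dots> = sum3 (*) (\<mu> x) (\<lambda>u v w. \<alpha> v * sum3 (*) (\<mu> y) (\<lambda>a b c. \<alpha> b * F (u * a) (w * c)))"
      by (simp add: sum3_scale[OF vector_space_mult] mult_ac)
    also have "\<dots> = sum2 (*) (comult x) (\<lambda>u v. sum2 (*) (comult y) (\<lambda>a b. F (u * a) (v * b)))"
      unfolding inner by (rule sum2_comult[symmetric]) (intro hg_linear_intros F_linear)
    finally show ?thesis .
  qed
next
  \<comment> \<open>In both counit laws the two scalars combine to \<open>\<alpha>\<close> of a
    product of adjacent factors of \<open>\<mu> x\<close>, to which a unit axiom applies.\<close>
  show "sum2 scale (comult x) (\<lambda>u v. scale (\<alpha> u) v) = x" for x
    using sum2_comult[of scale "\<lambda>u v. scale (\<alpha> u) v" x] sum3_hg_left_unit[of scale "\<lambda>p w. scale (\<alpha> p) w" x]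
    by (simp add: hg_linear_intros mult.commute)
  show "sum2 scale (comult x) (\<lambda>u v. scale (\<alpha> v) u) = x" for x
    using sum2_comult[of scale "\<lambda>u v. scale (\<alpha> v) u" x] sum3_hg_right_unit[of scale "\<lambda>u p. scale (\<alpha> p) u" x]
    by (simp add: hg_linear_intros)
qed

end

text \<open>The two outer terms of the bracket on the triple tensor product become the two terms on
  the tensor square, because \<open>\<alpha>\<close> is multiplicative on the middle factor. The
  counit is the given \<open>\<alpha>\<close> itself.\<close>

lemma (in poisson_hopf_galois_algebra) poisson_hopf_algebra_comult:
  assumes \<alpha>: "character \<alpha>" and br: "\<And>x y. \<alpha> (br x y) = 0"
  shows "\<exists>\<Delta> S. poisson_hopf_algebra scale br \<Delta> \<alpha> S"
proof -
  interpret hopf_galois_character scale \<mu> \<alpha> by unfold_locales fact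
  have "comult (br x y) = br_tensor2 (comult x) (comult y)" for x y
  proof (rule tensor_eqI[OF tensor_power_class[OF comult_power]])
    show "br_tensor2 (comult x) (comult y) \<in> range (tensor_class 2)"
      by (simp add: br_tensor2_def tensor_ops_class)
    fix \<phi> assume "multilinear 2 ((*) :: 'k \<Rightarrow> 'k \<Rightarrow> 'k) \<phi>"
    note \<phi> = this bilinear_map_linear[OF bilinear_map_list[OF this]]
    \<comment> \<open>One computation serves both terms of the bracket on the tensor square, with
      \<open>\<beta>\<close> and \<open>\<gamma>\<close> the multiplication and the bracket in
      either order.\<close>
    have bilinear: "sum2 (*) (comult x) (\<lambda>u v. sum2 (*) (comult y) (\<lambda>a b. \<phi> [\<beta> u a, \<gamma> v b])) =
        sum3 (*) (\<mu> x) (\<lambda>u v w. sum3 (*) (\<mu> y) (\<lambda>a b c. \<alpha> (v * b) * \<phi> [\<beta> u a, \<gamma> w c]))"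
      if \<beta>: "bilinear_map scale \<beta>" and \<gamma>: "bilinear_map scale \<gamma>" for \<beta> \<gamma>
    proof -
      note intros = hg_linear_intros bilinear_map_linear[OF \<beta>] bilinear_map_linear[OF \<gamma>] \<phi>(2,3)
      have inner: "sum2 (*) (comult y) (\<lambda>a b. \<phi> [\<beta> u a, \<gamma> v b]) =
          sum3 (*) (\<mu> y) (\<lambda>a b c. \<alpha> b * \<phi> [\<beta> u a, \<gamma> v c])" for u v
        by (intro sum2_comult intros)
      show ?thesis unfolding inner
        by (subst sum2_comult, intro intros)
          (simp add: sum3_scale[OF vector_space_mult] mult.assoc)
    qed
    have mult: "bilinear_map scale (*)"
      by (intro hg_linear_intros)
    have "tensor_sum (*) (comult (br x y)) \<phi> = sum3 (*) (\<mu> (br x y)) (\<lambda>u v w. \<alpha> v * \<phi> [u, w])"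
      by (rule tensor_sum_comult[OF \<phi>(1)])
    also have "\<dots> =
        sum3 (*) (\<mu> x) (\<lambda>u v w. sum3 (*) (\<mu> y) (\<lambda>a b c. \<alpha> (v * b) * \<phi> [br u a, w * c])) -
        sum3 (*) (\<mu> x) (\<lambda>u v w. sum3 (*) (\<mu> y) (\<lambda>a b c. \<alpha> (br v b) * \<phi> [u * a, w * c])) +
        sum3 (*) (\<mu> x) (\<lambda>u v w. sum3 (*) (\<mu> y) (\<lambda>a b c. \<alpha> (v * b) * \<phi> [u * a, br w c]))"
      by (rule sum3_hg_br) (intro hg_linear_intros \<phi>(2,3))
    also have "\<dots> = tensor_sum (*) (br_tensor2 (comult x) (comult y)) \<phi>"
      \<comment> \<open>The hypothesis named \<open>br\<close> turns the coefficients of the middle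
        term into 0; unfolding to finite sums lets that term disappear.\<close>
      unfolding sum2_br_tensor2[OF comult_power comult_power \<phi>(1)]
        bilinear[OF mult br_bilinear] bilinear[OF br_bilinear mult] br
      by (simp add: sum3_def tensor_sum_def lin_ext_def)
    finally show "tensor_sum (*) (comult (br x y)) \<phi> = tensor_sum (*) (br_tensor2 (comult x) (comult y)) \<phi>" .
  qed
  then have "poisson_hopf_algebra scale br comult \<alpha> antipode"
    by (intro poisson_hopf_algebra.intro poisson_hopf_algebra_axioms.intro poisson_algebra_axioms
        hopf_algebra_comult)
  then show ?thesis by blast
qed

section \<open>From Hopf to Hopf-Galois\<close>

text \<open>The part of the converse in which no bracket occurs. Commutativity lets the factors of
  an integrand be regrouped at will and makes the antipode multiplicative.\<close>

locale comm_hopf_algebra = hopf_algebra scale \<Delta> \<epsilon> S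
  for scale :: "'k::field \<Rightarrow> 'a::comm_ring_1 \<Rightarrow> 'a" and \<Delta> \<epsilon> S
begin

lemma counit_simps [simp]: "\<epsilon> 1 = 1" "\<epsilon> (x * y) = \<epsilon> x * \<epsilon> y"
  using counit_character by (auto simp: character_def)

lemmas antipode_linear_app = linear_compose_app[OF antipode_linear]

lemmas hopf_linear_intros = linear_intros character_linear[OF counit_character] antipode_linear_app
  linear_sum2[OF comult_linear] linear_sum2_param[OF _ comult_power] bilinear_mapI trilinear_mapI

lemma sum2_mult_const: "sum2 scale X F * c = sum2 scale X (\<lambda>u v. F u v * c)"
  by (rule linear_comp_sum2[of scale scale "\<lambda>z. z * c"]) (intro linear_intros)

lemma sum2_const_mult: "c * sum2 scale X F = sum2 scale X (\<lambda>u v. c * F u v)"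
  by (rule linear_comp_sum2[of scale scale "\<lambda>z. c * z"]) (intro linear_intros)

text \<open>On bilinear maps \<open>H \<times> H \<rightarrow> H\<close>, convolution with the multiplication
  is inverted by convolution with \<open>(x, y) \<mapsto> S x * S y\<close>.\<close>

lemma convolution_inverse:
  assumes "bilinear_map scale G"
  shows "sum2 scale (\<Delta> x) (\<lambda>u v. sum2 scale (\<Delta> y) (\<lambda>a b.
      sum2 scale (\<Delta> u) (\<lambda>p q. sum2 scale (\<Delta> a) (\<lambda>c d. G p c * (q * d))) * (S v * S b))) = G x y"
    (is "?L = _")
proof -
  note G = bilinear_map_linear[OF assms]
  note vs = vector_space_axioms
  have "?L = sum2 scale (\<Delta> x) (\<lambda>u v. sum2 scale (\<Delta> y) (\<lambda>a b.
      sum2 scale (\<Delta> u) (\<lambda>p q. sum2 scale (\<Delta> a) (\<lambda>c d. G p c * (q * d) * (S v * S b)))))"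
    by (simp only: sum2_mult_const)
  \<comment> \<open>The two sums over parts of \<open>x\<close> become adjacent, so that
    coassociativity applies to \<open>x\<close> with the sums over \<open>y\<close> inside the
    integrand.\<close>
  also have "\<dots> = sum2 scale (\<Delta> x) (\<lambda>u v. sum2 scale (\<Delta> u) (\<lambda>p q.
      sum2 scale (\<Delta> y) (\<lambda>a b. sum2 scale (\<Delta> a) (\<lambda>c d. G p c * (q * d) * (S v * S b)))))"
    by (subst sum2_swap[OF vs, of "\<Delta> y"]) (rule refl)
  also have "\<dots> = sum2 scale (\<Delta> x) (\<lambda>u v. sum2 scale (\<Delta> v) (\<lambda>p q.
      sum2 scale (\<Delta> y) (\<lambda>a b. sum2 scale (\<Delta> a) (\<lambda>c d. G u c * (p * d) * (S q * S b)))))"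
    by (rule sum2_coassoc) (intro hopf_linear_intros G)
  also have "\<dots> = sum2 scale (\<Delta> x) (\<lambda>u v. sum2 scale (\<Delta> v) (\<lambda>p q.
      sum2 scale (\<Delta> y) (\<lambda>a b. sum2 scale (\<Delta> b) (\<lambda>c d. G u a * (p * c) * (S q * S d)))))"
    by (subst sum2_coassoc) (intro hopf_linear_intros G, rule refl)
  \<comment> \<open>After regrouping in both variables, the last two of three legs meet as
    \<open>p * S q\<close> and \<open>c * S d\<close>, which the antipode axiom reduces to
    counits.\<close>
  also have "\<dots> = sum2 scale (\<Delta> x) (\<lambda>u v. sum2 scale (\<Delta> y) (\<lambda>a b.
      G u a * sum2 scale (\<Delta> v) (\<lambda>p q. p * S q) * sum2 scale (\<Delta> b) (\<lambda>c d. c * S d)))"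
    by (simp only: sum2_swap[OF vs, of _ "\<Delta> y"] sum2_const_mult sum2_mult_const mult_ac)
  also have "\<dots> = sum2 scale (\<Delta> x) (\<lambda>u v. sum2 scale (\<Delta> y) (\<lambda>a b.
      scale (\<epsilon> b) (scale (\<epsilon> v) (G u a))))"
    by (simp add: sum2_antipode_right scale_mult_right)
  also have "\<dots> = sum2 scale (\<Delta> x) (\<lambda>u v. scale (\<epsilon> v) (G u y))"
    by (subst sum2_counit_right) (intro hopf_linear_intros G, rule refl)
  also have "\<dots> = G x y"
    by (rule sum2_counit_right) (intro hopf_linear_intros G)
  finally show ?thesis .
qed

text \<open>The uniqueness principle for maps of two variables: a bilinear map is recovered from its
  convolution with the multiplication. It settles how the antipode treats products and
  brackets.\<close>

lemma convolution_cancel: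
  assumes "bilinear_map scale G" "bilinear_map scale G'"
    and "\<And>x y. sum2 scale (\<Delta> x) (\<lambda>u v. sum2 scale (\<Delta> y) (\<lambda>a b. G u a * (v * b))) =
      sum2 scale (\<Delta> x) (\<lambda>u v. sum2 scale (\<Delta> y) (\<lambda>a b. G' u a * (v * b)))"
  shows "G x y = G' x y"
  using convolution_inverse[OF assms(1), of x y] convolution_inverse[OF assms(2), of x y]
  by (simp only: assms(3))

lemma antipode_one: "S 1 = 1"
proof -
  have "sum2 scale (\<Delta> 1) (\<lambda>u v. S u * v) = S 1 * 1"
    by (rule sum2_comult_one) (intro hopf_linear_intros)
  then show ?thesis by (simp add: sum2_antipode_left)
qed

text \<open>Convolved with the multiplication, both sides give
  \<open>scale (\<epsilon> x * \<epsilon> y) 1\<close>.\<close>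

lemma antipode_mult: "S (x * y) = S x * S y"
proof (rule convolution_cancel[of "\<lambda>x y. S (x * y)" "\<lambda>x y. S x * S y"])
  fix x y
  have "sum2 scale (\<Delta> x) (\<lambda>u v. sum2 scale (\<Delta> y) (\<lambda>a b. S (u * a) * (v * b))) =
      sum2 scale (\<Delta> (x * y)) (\<lambda>u v. S u * v)"
    by (rule sum2_comult_mult[symmetric]) (intro hopf_linear_intros)
  also have "\<dots> = sum2 scale (\<Delta> x) (\<lambda>u v. S u * v) * sum2 scale (\<Delta> y) (\<lambda>u v. S u * v)"
    by (simp add: sum2_antipode_left scale_mult_left)
  also have "\<dots> = sum2 scale (\<Delta> x) (\<lambda>u v. sum2 scale (\<Delta> y) (\<lambda>a b. S u * S a * (v * b)))"
    by (simp only: sum2_mult_const sum2_const_mult mult_ac, subst sum2_swap[OF vector_space_axioms])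
      (simp only: mult_ac)
  finally show "sum2 scale (\<Delta> x) (\<lambda>u v. sum2 scale (\<Delta> y) (\<lambda>a b. S (u * a) * (v * b))) = \<dots>" .
qed (intro hopf_linear_intros)+

section \<open>The Hopf-Galois map of a commutative Hopf algebra\<close>

definition galois :: "'a \<Rightarrow> ('a list \<Rightarrow>\<^sub>0 'k) set" where
  "galois x = tensor_map 3 (\<lambda>xs. lin_ext free_scale
     (\<lambda>ys. gen [xs ! 0, S (ys ! 0), ys ! 1]) (tensor_rep (\<Delta> (xs ! 1)))) (\<Delta> x)"

lemma galois_power: "galois x \<in> tensor_power 3"
  unfolding galois_def
  by (rule tensor_map_power[OF comult_power], rule keys_lin_ext_subset) simp

lemma tensor_sum_galois:
  assumes "multilinear 3 s \<phi>"
  shows "tensor_sum s (galois x) \<phi> =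
    sum2 s (\<Delta> x) (\<lambda>u v. sum2 s (\<Delta> v) (\<lambda>a b. \<phi> [u, S a, b]))"
proof -
  have s: "vector_space s" using assms by (rule multilinear_vector_space)
  show ?thesis
    by (simp add: galois_def tensor_sum_map[OF assms] linear_comp_lin_ext[OF linear_lin_ext[OF s]]
        lin_ext_gen[OF s]) (simp add: sum2_def tensor_sum_def)
qed

lemma sum3_galois:
  "trilinear_map s F \<Longrightarrow> sum3 s (galois x) F =
    sum2 s (\<Delta> x) (\<lambda>u v. sum2 s (\<Delta> v) (\<lambda>a b. F u (S a) b))"
  unfolding sum3_def by (subst tensor_sum_galois[OF multilinear_3]) simp_all

lemma galois_linear: "linear_to_tensors 3 galois"
proof (rule linear_to_tensorsI[OF galois_power])
  fix \<phi> assume "multilinear 3 ((*) :: 'k \<Rightarrow> 'k \<Rightarrow> 'k) \<phi>"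
  note \<phi> = this trilinear_map_linear[OF trilinear_map_list[OF this]]
  show "Vector_Spaces.linear scale (*) (\<lambda>x. tensor_sum (*) (galois x) \<phi>)"
    unfolding tensor_sum_galois[OF \<phi>(1)] by (intro hopf_linear_intros \<phi>(2-4))
qed

lemmas galois_linear_intros = hopf_linear_intros linear_sum3[OF galois_linear] linear_sum3_param[OF _ galois_power]

lemma galois_mult:
  assumes "trilinear_map (*) F"
  shows "sum3 (*) (galois (x * y)) F =
    sum3 (*) (galois x) (\<lambda>u v w. sum3 (*) (galois y) (\<lambda>a b c. F (u * a) (b * v) (w * c)))"
proof -
  note F = trilinear_map_linear[OF assms]
  have "sum3 (*) (galois (x * y)) F =
      sum2 (*) (\<Delta> x) (\<lambda>u v. sum2 (*) (\<Delta> y) (\<lambda>u' v'. sum2 (*) (\<Delta> (v * v')) (\<lambda>a b. F (u * u') (S a) b)))"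
    unfolding sum3_galois[OF assms]
    by (rule sum2_comult_mult) (intro hopf_linear_intros F)
  also have "\<dots> = sum2 (*) (\<Delta> x) (\<lambda>u v. sum2 (*) (\<Delta> y) (\<lambda>u' v'.
      sum2 (*) (\<Delta> v) (\<lambda>a b. sum2 (*) (\<Delta> v') (\<lambda>a' b'. F (u * u') (S (a * a')) (b * b')))))"
    by (subst sum2_comult_mult) (intro hopf_linear_intros F, rule refl)
  \<comment> \<open>Commutativity allows the product of antipodes to be written in the reversed
    order that the opposite middle factor demands.\<close>
  also have "\<dots> = sum2 (*) (\<Delta> x) (\<lambda>u v. sum2 (*) (\<Delta> v) (\<lambda>a b.
      sum2 (*) (\<Delta> y) (\<lambda>u' v'. sum2 (*) (\<Delta> v') (\<lambda>a' b'. F (u * u') (S a' * S a) (b * b')))))"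
    by (subst (2) sum2_swap[OF vector_space_mult]) (simp only: antipode_mult mult.commute)
  also have "\<dots> = sum2 (*) (\<Delta> x) (\<lambda>u v. sum2 (*) (\<Delta> v) (\<lambda>a b.
      sum3 (*) (galois y) (\<lambda>u' v' w'. F (u * u') (v' * S a) (b * w'))))"
    by (subst sum3_galois) (intro hopf_linear_intros F, rule refl)
  also have "\<dots> = sum3 (*) (galois x) (\<lambda>u v w. sum3 (*) (galois y) (\<lambda>a b c. F (u * a) (b * v) (w * c)))"
    by (rule sum3_galois[symmetric]) (intro galois_linear_intros F)
  finally show ?thesis .
qed

text \<open>Both sides evaluate the fivefold coproduct of \<open>x\<close> with \<open>S\<close> on
  the second and fourth legs; they differ only in its bracketing.\<close>

lemma galois_coassoc:
  assumes "multilinear 5 (*) \<phi>"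
  shows "sum3 (*) (galois x) (\<lambda>u v w. sum3 (*) (galois u) (\<lambda>a b c. \<phi> [a, b, c, v, w])) =
    sum3 (*) (galois x) (\<lambda>u v w. sum3 (*) (galois w) (\<lambda>a b c. \<phi> [u, v, a, b, c]))"
proof -
  note F = multilinear_5_linear[OF assms]
  have inner: "sum3 (*) (galois u) (\<lambda>a b c. \<phi> [a, b, c, v, w]) =
      sum2 (*) (\<Delta> u) (\<lambda>a b. sum2 (*) (\<Delta> b) (\<lambda>c d. \<phi> [a, S c, d, v, w]))"
    "sum3 (*) (galois w) (\<lambda>a b c. \<phi> [u, v, a, b, c]) =
      sum2 (*) (\<Delta> w) (\<lambda>a b. sum2 (*) (\<Delta> b) (\<lambda>c d. \<phi> [u, v, a, S c, d]))" for u v w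
    by (intro sum3_galois hopf_linear_intros F)+
  have "sum3 (*) (galois x) (\<lambda>u v w. sum3 (*) (galois u) (\<lambda>a b c. \<phi> [a, b, c, v, w])) =
      sum2 (*) (\<Delta> x) (\<lambda>u v. sum2 (*) (\<Delta> v) (\<lambda>p q.
        sum2 (*) (\<Delta> u) (\<lambda>a b. sum2 (*) (\<Delta> b) (\<lambda>c d. \<phi> [a, S c, d, S p, q]))))"
    unfolding inner by (intro sum3_galois hopf_linear_intros F)
  also have "\<dots> = sum2 (*) (\<Delta> x) (\<lambda>u v. sum2 (*) (\<Delta> u) (\<lambda>a b.
      sum2 (*) (\<Delta> b) (\<lambda>c d. sum2 (*) (\<Delta> v) (\<lambda>p q. \<phi> [a, S c, d, S p, q]))))"
    by (subst sum2_swap[OF vector_space_mult], subst (2) sum2_swap[OF vector_space_mult]) (rule refl)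
  also have "\<dots> = sum2 (*) (\<Delta> x) (\<lambda>u v. sum2 (*) (\<Delta> v) (\<lambda>a b.
      sum2 (*) (\<Delta> a) (\<lambda>c d. sum2 (*) (\<Delta> b) (\<lambda>p q. \<phi> [u, S c, d, S p, q]))))"
    by (rule sum2_coassoc) (intro hopf_linear_intros F)
  also have "\<dots> = sum2 (*) (\<Delta> x) (\<lambda>u v. sum2 (*) (\<Delta> v) (\<lambda>a b.
      sum2 (*) (\<Delta> b) (\<lambda>c d. sum2 (*) (\<Delta> d) (\<lambda>p q. \<phi> [u, S a, c, S p, q]))))"
    by (subst sum2_coassoc) (intro hopf_linear_intros F, rule refl)
  also have "\<dots> = sum3 (*) (galois x) (\<lambda>u v w. sum3 (*) (galois w) (\<lambda>a b c. \<phi> [u, v, a, b, c]))"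
    unfolding inner by (rule sum3_galois[symmetric]) (intro hopf_linear_intros F)
  finally show ?thesis .
qed

lemma galois_left:
  assumes "bilinear_map (*) F"
  shows "sum3 (*) (galois x) (\<lambda>u v w. F (u * v) w) = F 1 x"
proof -
  note F = bilinear_map_linear[OF assms]
  have F_scale: "F (scale c p) q = c * F p q" for c p q
    using assms by (auto simp: bilinear_map_def linear_iff)
  have "sum3 (*) (galois x) (\<lambda>u v w. F (u * v) w) =
      sum2 (*) (\<Delta> x) (\<lambda>u v. sum2 (*) (\<Delta> v) (\<lambda>a b. F (u * S a) b))"
    by (intro sum3_galois hopf_linear_intros F)
  \<comment> \<open>\<open>galois\<close> comultiplies the second leg, whereas the antipode axiom
    needs the first two legs to come from one comultiplication.\<close>
  also have "\<dots> = sum2 (*) (\<Delta> x) (\<lambda>u v. sum2 (*) (\<Delta> u) (\<lambda>a b. F (a * S b) v))"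
    by (rule sum2_coassoc[symmetric]) (intro hopf_linear_intros F)
  also have "\<dots> = sum2 (*) (\<Delta> x) (\<lambda>u v. F (sum2 scale (\<Delta> u) (\<lambda>a b. a * S b)) v)"
    by (subst linear_comp_sum2[of scale "(*)" "\<lambda>z. F z _"]) (intro hopf_linear_intros F, rule refl)
  also have "\<dots> = sum2 (*) (\<Delta> x) (\<lambda>u v. \<epsilon> u * F 1 v)"
    by (simp add: sum2_antipode_right F_scale)
  also have "\<dots> = F 1 x"
    by (rule sum2_counit_left) (intro hopf_linear_intros F)
  finally show ?thesis .
qed

lemma galois_right:
  assumes "bilinear_map (*) F"
  shows "sum3 (*) (galois x) (\<lambda>u v w. F u (v * w)) = F x 1"
proof -
  note F = bilinear_map_linear[OF assms]
  have F_scale: "F p (scale c q) = c * F p q" for c p q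
    using assms by (auto simp: bilinear_map_def linear_iff)
  have "sum3 (*) (galois x) (\<lambda>u v w. F u (v * w)) =
      sum2 (*) (\<Delta> x) (\<lambda>u v. sum2 (*) (\<Delta> v) (\<lambda>a b. F u (S a * b)))"
    by (intro sum3_galois hopf_linear_intros F)
  also have "\<dots> = sum2 (*) (\<Delta> x) (\<lambda>u v. F u (sum2 scale (\<Delta> v) (\<lambda>a b. S a * b)))"
    by (subst linear_comp_sum2[of scale "(*)" "F _"]) (intro hopf_linear_intros F, rule refl)
  also have "\<dots> = sum2 (*) (\<Delta> x) (\<lambda>u v. \<epsilon> v * F u 1)"
    by (simp add: sum2_antipode_left F_scale)
  also have "\<dots> = F x 1"
    by (rule sum2_counit_right) (intro hopf_linear_intros F)
  finally show ?thesis .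
qed

lemma hopf_galois_algebra_galois: "hopf_galois_algebra scale galois"
proof (rule hopf_galois_algebraI[OF galois_linear _ galois_mult galois_coassoc galois_left galois_right])
  fix F :: "'a \<Rightarrow> 'a \<Rightarrow> 'a \<Rightarrow> 'k" assume "trilinear_map (*) F"
  note F = this trilinear_map_linear[OF this]
  have "sum3 (*) (galois 1) F = sum2 (*) (\<Delta> 1) (\<lambda>a b. F 1 (S a) b)"
    unfolding sum3_galois[OF F(1)] by (rule sum2_comult_one) (intro hopf_linear_intros F(2-4))
  also have "\<dots> = F 1 (S 1) 1"
    by (rule sum2_comult_one) (intro hopf_linear_intros F(2-4))
  finally show "sum3 (*) (galois 1) F = F 1 1 1"
    by (simp add: antipode_one)
qed

end

section \<open>Brackets under the counit, the antipode and the Hopf-Galois map\<close>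

context poisson_hopf_algebra
begin

sublocale comm_hopf_algebra scale \<Delta> \<epsilon> S ..

lemmas poisson_linear_intros = hopf_linear_intros br_linear

text \<open>Applying the counit to both legs of \<open>\<Delta> (br x y)\<close>, each of the two
  terms collapses to \<open>\<epsilon> (br x y)\<close>. So this scalar e satisfies e = e + e, which
  forces e = 0 in every characteristic.\<close>

lemma counit_br: "\<epsilon> (br x y) = 0"
proof -
  have \<epsilon>: "\<epsilon> (scale c z) = c * \<epsilon> z" for c z
    using counit_character by (auto simp: character_def linear_iff)
  have \<epsilon>_linear: "Vector_Spaces.linear scale (*) \<epsilon>"
    using counit_character by (auto simp: character_def)
  have "\<epsilon> (br x y) = sum2 (*) (\<Delta> (br x y)) (\<lambda>u v. \<epsilon> u * \<epsilon> v)"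
    by (rule sum2_counit_left[OF \<epsilon>_linear, symmetric])
  also have "\<dots> =
      sum2 (*) (\<Delta> x) (\<lambda>u v. sum2 (*) (\<Delta> y) (\<lambda>a b. \<epsilon> u * (\<epsilon> a * \<epsilon> (br v b)))) +
      sum2 (*) (\<Delta> x) (\<lambda>u v. sum2 (*) (\<Delta> y) (\<lambda>a b. \<epsilon> v * (\<epsilon> b * \<epsilon> (br u a))))"
    by (subst sum2_comult_br) (intro poisson_linear_intros, simp add: mult_ac)
  also have "sum2 (*) (\<Delta> x) (\<lambda>u v. sum2 (*) (\<Delta> y) (\<lambda>a b. \<epsilon> u * (\<epsilon> a * \<epsilon> (br v b)))) = \<epsilon> (br x y)"
    \<comment> \<open>Pulling \<open>\<epsilon> u\<close> out of the sum over
      \<open>\<Delta> y\<close> gives the outer sum the shape of the counit axiom.\<close>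
    unfolding sum2_scale[OF vector_space_mult, symmetric]
    by (subst sum2_counit_left, intro poisson_linear_intros, subst sum2_counit_left)
      (intro poisson_linear_intros, rule refl)
  also have "sum2 (*) (\<Delta> x) (\<lambda>u v. sum2 (*) (\<Delta> y) (\<lambda>a b. \<epsilon> v * (\<epsilon> b * \<epsilon> (br u a)))) = \<epsilon> (br x y)"
    unfolding sum2_scale[OF vector_space_mult, symmetric]
    by (subst sum2_counit_right, intro poisson_linear_intros, subst sum2_counit_right)
      (intro poisson_linear_intros, rule refl)
  finally show ?thesis by (simp only: add_cancel_right_right)
qed

text \<open>Integration by parts: the derivation \<open>br y\<close> kills the multiple of 1 to
  which \<open>S u * v\<close> sums, so by Leibniz the bracket moves from one leg to the other at
  the cost of a sign.\<close>

lemma sum2_antipode_br: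
  "sum2 scale (\<Delta> x) (\<lambda>u v. S u * br v y) = - sum2 scale (\<Delta> x) (\<lambda>u v. br (S u) y * v)"
proof -
  have "0 = br y (sum2 scale (\<Delta> x) (\<lambda>u v. S u * v))"
    by (simp add: sum2_antipode_left br_scale br_one)
  also have "\<dots> = sum2 scale (\<Delta> x) (\<lambda>u v. br y (S u * v))"
    by (rule linear_comp_sum2) (intro poisson_linear_intros)
  also have "\<dots> = sum2 scale (\<Delta> x) (\<lambda>u v. - (br (S u) y * v + S u * br v y))"
    by (simp add: br_leibniz br_antisym[of y])
  also have "\<dots> = - (sum2 scale (\<Delta> x) (\<lambda>u v. br (S u) y * v) + sum2 scale (\<Delta> x) (\<lambda>u v. S u * br v y))"
    by (simp only: sum2_minus[OF vector_space_axioms] sum2_add[OF vector_space_axioms])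
  finally show ?thesis by (simp add: eq_neg_iff_add_eq_0 add.commute)
qed

text \<open>Since the counit kills brackets, the antipode axiom for \<open>br x y\<close> expands
  into two terms with sum 0. One is the convolution of \<open>S (br x y)\<close> with the
  multiplication; the other becomes the convolution of \<open>br (S y) (S x)\<close>, up to sign,
  after integrating by parts once in \<open>x\<close> and once in \<open>y\<close>.\<close>

lemma antipode_br: "S (br x y) = br (S y) (S x)"
proof (rule convolution_cancel[of "\<lambda>x y. S (br x y)" "\<lambda>x y. br (S y) (S x)"])
  fix x y
  let ?sum = "\<lambda>G. sum2 scale (\<Delta> x) (\<lambda>u v. sum2 scale (\<Delta> y) (\<lambda>a b. G u v a b))"
  have "0 = sum2 scale (\<Delta> (br x y)) (\<lambda>u v. S u * v)"
    by (simp add: sum2_antipode_left counit_br)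
  also have "\<dots> = ?sum (\<lambda>u v a b. S (u * a) * br v b) + ?sum (\<lambda>u v a b. S (br u a) * (v * b))"
    by (rule sum2_comult_br) (intro poisson_linear_intros)
  finally have "?sum (\<lambda>u v a b. S (br u a) * (v * b)) = - ?sum (\<lambda>u v a b. S (u * a) * br v b)"
    by (simp add: eq_neg_iff_add_eq_0 add.commute)
  also have "?sum (\<lambda>u v a b. S (u * a) * br v b) =
      sum2 scale (\<Delta> y) (\<lambda>a b. S a * sum2 scale (\<Delta> x) (\<lambda>u v. S u * br v b))"
    by (subst sum2_swap[OF vector_space_axioms]) (simp only: antipode_mult sum2_const_mult mult_ac)
  also have "\<dots> = - sum2 scale (\<Delta> y) (\<lambda>a b. sum2 scale (\<Delta> x) (\<lambda>u v. S a * (br (S u) b * v)))"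
    unfolding sum2_antipode_br by (simp add: sum2_minus[OF vector_space_axioms] sum2_const_mult)
  \<comment> \<open>Antisymmetry absorbs the sign and puts \<open>b\<close> into the first argument,
    where integration by parts in \<open>y\<close> needs it.\<close>
  also have "\<dots> = sum2 scale (\<Delta> x) (\<lambda>u v. v * sum2 scale (\<Delta> y) (\<lambda>a b. S a * br b (S u)))"
    by (subst sum2_swap[OF vector_space_axioms])
      (simp add: sum2_minus[OF vector_space_axioms, symmetric] sum2_const_mult br_antisym[of _ "S _"] mult_ac)
  also have "\<dots> = - ?sum (\<lambda>u v a b. v * (br (S a) (S u) * b))"
    unfolding sum2_antipode_br by (simp add: sum2_minus[OF vector_space_axioms] sum2_const_mult)
  finally show "?sum (\<lambda>u v a b. S (br u a) * (v * b)) = ?sum (\<lambda>u v a b. br (S a) (S u) * (v * b))"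
    by (simp add: mult_ac)
qed (intro poisson_linear_intros)+

lemma galois_br: "galois (br x y) = br_tensor3 (galois x) (galois y)"
proof (rule tensor_eqI[OF tensor_power_class[OF galois_power]])
  show "br_tensor3 (galois x) (galois y) \<in> range (tensor_class 3)"
    by (simp add: br_tensor3_def tensor_ops_class)
  fix \<phi> assume "multilinear 3 ((*) :: 'k \<Rightarrow> 'k \<Rightarrow> 'k) \<phi>"
  note \<phi> = this trilinear_map_linear[OF trilinear_map_list[OF this]]
  let ?sum = "\<lambda>G. sum2 (*) (\<Delta> x) (\<lambda>u v. sum2 (*) (\<Delta> v) (\<lambda>a b.
      sum2 (*) (\<Delta> y) (\<lambda>u' v'. sum2 (*) (\<Delta> v') (\<lambda>a' b'. G u a b u' a' b'))))"
  \<comment> \<open>Fixing \<open>\<Delta> y\<close> orients the swap: it only moves this sum inward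
    past sums that do not depend on its legs, so it can serve as a rewrite rule.\<close>
  note swap = sum2_swap[OF vector_space_mult, of "\<Delta> y"]
  have bilinear: "sum3 (*) (galois x) (\<lambda>u v w. sum3 (*) (galois y) (\<lambda>a b c. \<phi> [\<beta> u a, \<gamma> v b, \<delta> w c])) =
      ?sum (\<lambda>u a b u' a' b'. \<phi> [\<beta> u u', \<gamma> (S a) (S a'), \<delta> b b'])"
    if \<beta>: "bilinear_map scale \<beta>" and \<gamma>: "bilinear_map scale \<gamma>" and \<delta>: "bilinear_map scale \<delta>" for \<beta> \<gamma> \<delta>
  proof -
    note intros = galois_linear_intros bilinear_map_linear[OF \<beta>] bilinear_map_linear[OF \<gamma>]
      bilinear_map_linear[OF \<delta>] \<phi>(2-4)
    have inner: "sum3 (*) (galois y) (\<lambda>a b c. \<phi> [\<beta> u a, \<gamma> v b, \<delta> w c]) =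
        sum2 (*) (\<Delta> y) (\<lambda>u' v'. sum2 (*) (\<Delta> v') (\<lambda>a' b'. \<phi> [\<beta> u u', \<gamma> v (S a'), \<delta> w b']))" for u v w
      by (intro sum3_galois intros)
    show ?thesis unfolding inner by (intro sum3_galois intros)
  qed
  have mult: "bilinear_map scale (*)"
    by (intro hopf_linear_intros)
  \<comment> \<open>This sign becomes the minus sign of the middle term of
    \<open>br_tensor3\<close>.\<close>
  have S_br: "S (br a b) = - br (S a) (S b)" for a b
    unfolding antipode_br by (rule br_antisym)
  have \<phi>_minus: "\<phi> [u, - v, w] = - \<phi> [u, v, w]" for u v w
    using module_hom.neg[of scale "(*)" "\<lambda>v. \<phi> [u, v, w]"] \<phi>(3)[OF linear_id]
    by (simp add: module_hom_iff_linear)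
  have "tensor_sum (*) (galois (br x y)) \<phi> =
      sum2 (*) (\<Delta> (br x y)) (\<lambda>u v. sum2 (*) (\<Delta> v) (\<lambda>a b. \<phi> [u, S a, b]))"
    by (rule tensor_sum_galois[OF \<phi>(1)])
  \<comment> \<open>The first comultiplication gives two terms. The one with a bracket in its second
    leg splits again, which makes three in all, as many as \<open>br_tensor3\<close> has.\<close>
  also have "\<dots> =
      sum2 (*) (\<Delta> x) (\<lambda>u v. sum2 (*) (\<Delta> y) (\<lambda>u' v'. sum2 (*) (\<Delta> (br v v')) (\<lambda>a b. \<phi> [u * u', S a, b]))) +
      sum2 (*) (\<Delta> x) (\<lambda>u v. sum2 (*) (\<Delta> y) (\<lambda>u' v'. sum2 (*) (\<Delta> (v * v')) (\<lambda>a b. \<phi> [br u u', S a, b])))"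
    by (rule sum2_comult_br) (intro poisson_linear_intros \<phi>(2-4))
  also have "sum2 (*) (\<Delta> x) (\<lambda>u v. sum2 (*) (\<Delta> y) (\<lambda>u' v'. sum2 (*) (\<Delta> (v * v')) (\<lambda>a b. \<phi> [br u u', S a, b]))) =
      ?sum (\<lambda>u a b u' a' b'. \<phi> [br u u', S a * S a', b * b'])"
    by (subst sum2_comult_mult, intro poisson_linear_intros \<phi>(2-4), subst swap) (simp only: antipode_mult)
  also have "sum2 (*) (\<Delta> x) (\<lambda>u v. sum2 (*) (\<Delta> y) (\<lambda>u' v'. sum2 (*) (\<Delta> (br v v')) (\<lambda>a b. \<phi> [u * u', S a, b]))) =
      ?sum (\<lambda>u a b u' a' b'. \<phi> [u * u', S a * S a', br b b']) -
      ?sum (\<lambda>u a b u' a' b'. \<phi> [u * u', br (S a) (S a'), b * b'])"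
  proof -
    \<comment> \<open>The difference is written as a sum with a negated term, the form in which
      \<open>sum2_add\<close> and \<open>sum2_minus\<close> distribute over the outer sums.\<close>
    have "sum2 (*) (\<Delta> (br v v')) (\<lambda>a b. \<phi> [u * u', S a, b]) =
        sum2 (*) (\<Delta> v) (\<lambda>a b. sum2 (*) (\<Delta> v') (\<lambda>a' b'. \<phi> [u * u', S a * S a', br b b'])) +
        - sum2 (*) (\<Delta> v) (\<lambda>a b. sum2 (*) (\<Delta> v') (\<lambda>a' b'. \<phi> [u * u', br (S a) (S a'), b * b']))" for u u' v v'
      by (subst sum2_comult_br, intro poisson_linear_intros \<phi>(2-4))
        (simp add: antipode_mult S_br \<phi>_minus sum2_minus[OF vector_space_mult])
    then show ?thesis
      by (simp only: sum2_add[OF vector_space_mult] sum2_minus[OF vector_space_mult] swap) simp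
  qed
  finally show "tensor_sum (*) (galois (br x y)) \<phi> = tensor_sum (*) (br_tensor3 (galois x) (galois y)) \<phi>"
    unfolding sum3_br_tensor3[OF galois_power galois_power \<phi>(1)]
      bilinear[OF mult mult br_bilinear] bilinear[OF mult br_bilinear mult] bilinear[OF br_bilinear mult mult]
    by simp
qed

lemma poisson_hopf_galois_algebra_galois: "poisson_hopf_galois_algebra scale br galois"
  by (intro poisson_hopf_galois_algebra.intro poisson_hopf_galois_algebra_axioms.intro
      poisson_algebra_axioms hopf_galois_algebra_galois galois_br)

end

theorem proposition3p7:
  fixes scale :: "'k::field \<Rightarrow> 'a::comm_ring_1 \<Rightarrow> 'a"
    and br :: "'a \<Rightarrow> 'a \<Rightarrow> 'a"
  assumes "poisson_algebra scale br"
  shows "(\<forall>\<mu>. poisson_hopf_galois_algebra scale br \<mu> \<longrightarrow>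
            (\<exists>\<alpha>. k_algebra.character scale \<alpha> \<and> {br x y | x y. True} \<subseteq> {z. \<alpha> z = 0}) \<longrightarrow>
            (\<exists>\<Delta> \<epsilon> S. poisson_hopf_algebra scale br \<Delta> \<epsilon> S)) \<and>
         (\<forall>\<Delta> \<epsilon> S. poisson_hopf_algebra scale br \<Delta> \<epsilon> S \<longrightarrow>
            (\<exists>\<mu>. poisson_hopf_galois_algebra scale br \<mu>))"
proof (intro conjI allI impI)
  fix \<mu>
  assume \<mu>: "poisson_hopf_galois_algebra scale br \<mu>"
    and "\<exists>\<alpha>. k_algebra.character scale \<alpha> \<and> {br x y | x y. True} \<subseteq> {z. \<alpha> z = 0}"
  then obtain \<alpha> where \<alpha>: "k_algebra.character scale \<alpha>" "\<And>x y. \<alpha> (br x y) = 0"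
    by blast
  show "\<exists>\<Delta> \<epsilon> S. poisson_hopf_algebra scale br \<Delta> \<epsilon> S"
    using poisson_hopf_galois_algebra.poisson_hopf_algebra_comult[OF \<mu> \<alpha>] by blast
next
  fix \<Delta> \<epsilon> S
  assume "poisson_hopf_algebra scale br \<Delta> \<epsilon> S"
  then show "\<exists>\<mu>. poisson_hopf_galois_algebra scale br \<mu>"
    using poisson_hopf_algebra.poisson_hopf_galois_algebra_galois by blast
qed

end
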